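(* Suppose that the following three statements (A), (B), (C) hold. (A) There is a constant $c>0$ such that $\mathrm m(C_{\kappa(n)})\ge c\log\kappa(n)$ for all but $o(X)$ odd integers $n\le X$, as $X\to+\infty$. (B) There are constants $c_1,c_2>0$ such that $c_1\,\mathrm m(C_{\kappa(n)})\le \mathrm m(\alpha_n)/n\le c_2\,\mathrm m(C_{\kappa(n)})$ for all but $o(X)$ odd integers $n\le X$, as $X\to+\infty$. (C) (Specific case of the prime tuplets conjecture.) For a fixed constant $b$ and distinct positive integers $r_1,\dots,r_\ell\le b\log x$, with $w(p)$ denoting for each prime $p$ the number of distinct solutions $q \bmod p$ of $\prod_{j=1}^\ell(qr_j+1)\equiv0\bmod p$, one has $$\#\{q\in\mathbf Z: x\le q<2x,\ \text{each } qr_j+1 \text{ prime}\}=(1+o_{b,\ell}(1))\frac{x}{(\log x)^\ell}\prod_p\frac{1-w(p)/p}{(1-1/p)^\ell},$$ where the product extends over all primes. Then there are constants $c_3,c_4>0$ such that $c_3\,n\log\log n\le\mathrm m(\alpha_n)\le c_4\,n\log\log n$ for all but $o(X)$ odd values of $n\le X$, as $X\to+\infty$.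
   Context: For a positive integer $n$, $\kappa(n)$ is the smallest positive integer such that $p=\kappa(n)n+1$ is prime, and the Gaussian period is $\alpha_n:=\sum_{\sigma\in H}\zeta_p^\sigma$, where $\zeta_p$ is a primitive $p$-th root of unity and $H$ is the unique subgroup of order $\kappa(n)$ of $\mathrm{Gal}(\mathbf Q(\zeta_p)/\mathbf Q)$. For an algebraic integer $\alpha$, $\mathrm m(\alpha):=\sum_{\alpha'}\max\{0,\log|\alpha'|\}$ over all conjugates $\alpha'$ of $\alpha$ over $\mathbf Q$. For $k\ge1$ let $d=\phi(k)$ and $\zeta_k$ a primitive $k$-th root of unity. Every $k$-th root of unity is uniquely an integer linear combination of $1,\zeta_k,\dots,\zeta_k^{d-1}$; let $A_k\subset\mathbf Z^d$ be the set of the $k$ coefficient vectors, $F_k(\mathbf x):=\sum_{\mathbf a\in A_k}\mathbf x^{\mathbf a}$, $\mathbf x=(x_1,\dots,x_d)$. Then $C_k$ is the hypersurface $x_0+F_k(\mathbf x)=0$ in $\mathbf G_m^{d+1}$ and $\mathrm m(C_k):=\int_{\mathbf T^{d+1}}\log|x_0+F_k(\mathbf x)|\,d\mu$, with $\mathbf T$ the complex unit circle and $\mu$ normalized Haar measure. *)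

theory Defs
  imports
    "HOL-Algebra.Algebraic_Closure_Type"
    "HOL-Algebra.Generated_Fields"
    "HOL-Algebra.Bij"
    "HOL-Number_Theory.Totient"
    "HOL-Library.Landau_Symbols"
    "HOL-Analysis.Analysis"
begin

definition \<kappa> :: "nat \<Rightarrow> nat" where
  "\<kappa> n = (LEAST k. 0 < k \<and> prime (k * n + 1))"

definition prim_root :: "nat \<Rightarrow> complex" where
  "prim_root k = cis (2 * pi / real k)"

abbreviation complex_field :: "complex ring" where
  "complex_field \<equiv> ring_of_type_algebra"

definition rat_adjoin :: "complex \<Rightarrow> complex set" where
  "rat_adjoin z = generate_field complex_field {z}"

text \<open>
  The Galois group of a subfield \<open>L\<close> of the complex numbers over the rationals. As in the library
  group of bijections, automorphisms are extensional functions on \<open>L\<close>, so that distinct elements of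
  the group are distinct as automorphisms.
\<close>

definition galois_group :: "complex set \<Rightarrow> (complex \<Rightarrow> complex) monoid" where
  "galois_group L = BijGroup L
     \<lparr>carrier := {\<sigma> \<in> Bij L.
        \<sigma> \<in> ring_hom (complex_field\<lparr>carrier := L\<rparr>) (complex_field\<lparr>carrier := L\<rparr>) \<and>
        (\<forall>x \<in> \<rat>. \<sigma> x = x)}\<rparr>"

text \<open>
  \<open>L\<close> below is a cyclotomic field of prime conductor, so its Galois group is cyclic of order
  \<open>\<kappa> n * n\<close> and has exactly one subgroup of order \<open>\<kappa> n\<close>. Another choice of the primitive root of
  unity would replace the period by one of its conjugates.
\<close>

definition gaussian_period :: "nat \<Rightarrow> complex" where
  "gaussian_period n =
    (let \<zeta> = prim_root (\<kappa> n * n + 1);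
         L = rat_adjoin \<zeta>;
         H = (THE H. subgroup H (galois_group L) \<and> card H = \<kappa> n)
     in \<Sum>\<sigma>\<in>H. \<sigma> \<zeta>)"

text \<open>
  The conjugates of an algebraic number over the rationals: the roots of its minimal polynomial.
  They are distinct because the minimal polynomial is separable, so a set suffices.
\<close>

definition conjugates :: "complex \<Rightarrow> complex set" where
  "conjugates \<alpha> =
     {z. ring.eval complex_field (ring.Irr complex_field \<rat> \<alpha>) z = 0}"

text \<open>
  The conjugate \<open>0\<close> contributes \<open>0\<close>, as it should, since \<^term>\<open>ln (0 :: real) = 0\<close>.
\<close>

definition log_mahler :: "complex \<Rightarrow> real" where
  "log_mahler \<alpha> = (\<Sum>\<beta>\<in>conjugates \<alpha>. max 0 (ln (norm \<beta>)))"

text \<open>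
  An integer vector of length \<open>d\<close> is a function on \<open>nat\<close> that vanishes outside \<open>{1..d}\<close>; its entry
  at \<open>i\<close> is the coefficient of \<open>\<zeta> ^ (i - 1)\<close> and the exponent of the variable \<open>x i\<close>. For a \<open>k\<close>-th
  root of unity the vector exists and is unique, because \<open>1, \<zeta>, \<dots>, \<zeta> ^ (totient k - 1)\<close> is an
  integral basis of the ring generated by \<open>\<zeta>\<close>. The set of these vectors does not depend on which
  primitive \<open>k\<close>-th root of unity \<open>\<zeta>\<close> is used.
\<close>

definition coeff_vector :: "nat \<Rightarrow> complex \<Rightarrow> nat \<Rightarrow> int" where
  "coeff_vector k z =
    (THE a. (\<forall>i. i \<notin> {1..totient k} \<longrightarrow> a i = 0) \<and>
            z = (\<Sum>i\<in>{1..totient k}. of_int (a i) * prim_root k ^ (i - 1)))"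

definition exponents_F :: "nat \<Rightarrow> (nat \<Rightarrow> int) set" where
  "exponents_F k = coeff_vector k ` {z. z ^ k = 1}"

definition eval_F :: "nat \<Rightarrow> (nat \<Rightarrow> complex) \<Rightarrow> complex" where
  "eval_F k x = (\<Sum>a\<in>exponents_F k. \<Prod>i\<in>{1..totient k}. x i powi a i)"

text \<open>
  Normalized Haar measure on the unit circle is the image of Lebesgue measure on \<open>[0, 1)\<close>, and on
  the torus with coordinates \<open>x 0, \<dots>, x d\<close> it is the product measure.
\<close>

definition circle_measure :: "complex measure" where
  "circle_measure =
     distr (uniform_measure lborel {0..<1}) (restrict_space borel (sphere 0 1))
       (\<lambda>t::real. cis (2 * pi * t))"

definition torus_measure :: "nat \<Rightarrow> (nat \<Rightarrow> complex) measure" where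
  "torus_measure d = PiM {0..d} (\<lambda>_. circle_measure)"

definition log_mahler_C :: "nat \<Rightarrow> real" where
  "log_mahler_C k =
     (\<integral>x. ln (norm (x 0 + eval_F k x)) \<partial>torus_measure (totient k))"

definition for_almost_all_odd :: "(nat \<Rightarrow> bool) \<Rightarrow> bool" where
  "for_almost_all_odd P \<longleftrightarrow>
     (\<lambda>x::real. real (card {n. odd n \<and> real n \<le> x \<and> \<not> P n})) \<in> o[at_top](\<lambda>x. x)"

definition num_solutions :: "(nat \<Rightarrow> nat) \<Rightarrow> nat \<Rightarrow> nat \<Rightarrow> nat" where
  "num_solutions r l p = card {q. q < p \<and> p dvd (\<Prod>j\<in>{1..l}. q * r j + 1)}"

definition singular_series :: "(nat \<Rightarrow> nat) \<Rightarrow> nat \<Rightarrow> real" where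
  "singular_series r l =
     (\<Prod>p. if prime p
          then (1 - real (num_solutions r l p) / real p) / (1 - 1 / real p) ^ l else 1)"

definition tuplet_count :: "(nat \<Rightarrow> nat) \<Rightarrow> nat \<Rightarrow> real \<Rightarrow> nat" where
  "tuplet_count r l x =
     card {q::int. x \<le> of_int q \<and> of_int q < 2 * x \<and>
                   (\<forall>j\<in>{1..l}. prime (q * int (r j) + 1))}"

text \<open>
  The error term depends on \<open>b\<close> and \<open>l\<close> only: the asymptotic formula is uniform in the \<open>r j\<close>.
\<close>

definition prime_tuplets_conjecture :: bool where
  "prime_tuplets_conjecture \<longleftrightarrow>
     (\<forall>b::real. \<forall>l::nat. b > 0 \<longrightarrow> l \<ge> 1 \<longrightarrow>
       (\<forall>\<epsilon>>0. \<forall>\<^sub>F x in at_top. \<forall>r.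
          inj_on r {1..l} \<and> (\<forall>j\<in>{1..l}. 0 < r j \<and> real (r j) \<le> b * ln x) \<longrightarrow>
          \<bar>real (tuplet_count r l x) - x / ln x ^ l * singular_series r l\<bar>
            \<le> \<epsilon> * (x / ln x ^ l * singular_series r l)))"

end

theory Submission
  imports Defs "HOL-Real_Asymp.Real_Asymp" "HOL-Probability.Infinite_Product_Measure"
begin

text \<open>
  Up to constants, (A) and (B) place \<open>log_mahler (gaussian_period n) / n\<close> between \<open>ln (\<kappa> n)\<close> and
  \<open>log_mahler_C (\<kappa> n)\<close>, and the latter is at most \<open>ln (\<kappa> n + 1)\<close> because \<open>x\<^sub>0 + F\<^sub>k\<close> is a sum of
  at most \<open>k + 1\<close> monomials of modulus \<open>1\<close> on the torus (\<open>log_mahler_C_le\<close>). So the theorem says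
  that \<open>\<kappa> n\<close> lies between two fixed positive powers of \<open>ln n\<close> for almost all odd \<open>n\<close>; the proof
  gives the exponents \<open>1 / 3\<close> and \<open>2\<close> (\<open>almost_all_kappa_bounds\<close>). Both bounds come from (C).

  For the lower bound, (C) for a single form shows that \<open>k * q + 1\<close> is prime for at most about
  \<open>S k * x / ln x\<close> integers \<open>q\<close> in \<open>[x, 2 * x)\<close>, where the singular series \<open>S k\<close> is the product of
  \<open>p / (p - 1)\<close> over the primes \<open>p\<close> dividing \<open>k\<close>, hence is at most \<open>k\<close>. Summed over
  \<open>k \<le> (ln x) powr (1 / 3)\<close> this is of order \<open>x / (ln x) powr (1 / 3)\<close>.

  The upper bound is a second moment argument. The number of \<open>k \<le> b * ln x\<close> for which \<open>k * q + 1\<close>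
  is prime is not concentrated around its mean, because it is larger for those \<open>q\<close> that have many
  small prime factors. This bias disappears if only multiples \<open>k = fact y * j\<close> with \<open>j \<le> M * ln x\<close>
  are counted: then \<open>k * q + 1\<close> is prime to all \<open>p \<le> y\<close> whatever \<open>q\<close> is. Let each such \<open>k\<close> be
  counted with weight \<open>1 / S k\<close>. By (C) for one form the mean is about \<open>M\<close>. By (C) for two forms the
  correlation of \<open>fact y * i\<close> and \<open>fact y * j\<close> is at most the product of \<open>p / (p - 1)\<close> over the
  primes \<open>p > y\<close> dividing \<open>i - j\<close> (\<open>singular_series_multiples_le\<close>), and on average over \<open>i\<close> and
  \<open>j\<close> this product exceeds \<open>1\<close> by at most twice the tail of \<open>\<Sum>d. d powr (- 3 / 2)\<close> beyond \<open>y\<close>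
  (\<open>sum_divisor_tail_le\<close>). So the variance is small compared with the square of the mean once \<open>y\<close>
  and \<open>M\<close> are large, and few \<open>q\<close> have count \<open>0\<close> (\<open>few_without_small_multiplier\<close>).

  The constant \<open>b = fact y * M\<close> depends on the proportion of exceptions that is allowed. It is
  absorbed by bounding \<open>b * ln x\<close> by \<open>(ln x)\<^sup>2\<close>.
\<close>

section \<open>Properties of almost all odd integers\<close>

lemma finite_nat_real_le [simp]: "finite {n. real n \<le> x \<and> Q n}"
  by (rule finite_subset[of _ "{..nat \<lfloor>x\<rfloor>}"]) (auto simp: le_nat_floor)

lemma finite_odd_exceptions [simp]: "finite {n. odd n \<and> real n \<le> x \<and> \<not> P n}"
  by (rule finite_subset[OF _ finite_nat_real_le[of x "\<lambda>_. True"]]) auto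

lemma for_almost_all_odd_iff:
  "for_almost_all_odd P \<longleftrightarrow>
    (\<forall>\<epsilon>>0. \<forall>\<^sub>F x in at_top. real (card {n. odd n \<and> real n \<le> x \<and> \<not> P n}) \<le> \<epsilon> * x)"
  (is "_ \<longleftrightarrow> ?R")
proof
  assume P: "for_almost_all_odd P"
  show ?R
  proof (intro allI impI)
    fix \<epsilon> :: real assume "\<epsilon> > 0"
    from landau_o.smallD[OF P[unfolded for_almost_all_odd_def] this] eventually_ge_at_top[of 0]
    show "\<forall>\<^sub>F x in at_top. real (card {n. odd n \<and> real n \<le> x \<and> \<not> P n}) \<le> \<epsilon> * x"
      by eventually_elim simp
  qed
next
  assume R: ?R
  show "for_almost_all_odd P" unfolding for_almost_all_odd_def
  proof (rule landau_o.smallI)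
    fix \<epsilon> :: real assume "\<epsilon> > 0"
    with R have "\<forall>\<^sub>F x in at_top. real (card {n. odd n \<and> real n \<le> x \<and> \<not> P n}) \<le> \<epsilon> * x"
      by blast
    with eventually_ge_at_top[of 0]
    show "\<forall>\<^sub>F x in at_top. norm (real (card {n. odd n \<and> real n \<le> x \<and> \<not> P n})) \<le> \<epsilon> * norm x"
      by eventually_elim simp
  qed
qed

lemma for_almost_all_odd_mono:
  assumes "for_almost_all_odd P" "\<And>n. P n \<Longrightarrow> Q n"
  shows "for_almost_all_odd Q"
  unfolding for_almost_all_odd_iff
proof (intro allI impI)
  fix \<epsilon> :: real assume "\<epsilon> > 0"
  with assms(1) have "\<forall>\<^sub>F x in at_top. real (card {n. odd n \<and> real n \<le> x \<and> \<not> P n}) \<le> \<epsilon> * x"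
    unfolding for_almost_all_odd_iff by blast
  then show "\<forall>\<^sub>F x in at_top. real (card {n. odd n \<and> real n \<le> x \<and> \<not> Q n}) \<le> \<epsilon> * x"
  proof eventually_elim
    case (elim x)
    have "card {n. odd n \<and> real n \<le> x \<and> \<not> Q n} \<le> card {n. odd n \<and> real n \<le> x \<and> \<not> P n}"
      using assms(2) by (intro card_mono) auto
    with elim show ?case by linarith
  qed
qed

lemma for_almost_all_odd_conj:
  assumes "for_almost_all_odd P" "for_almost_all_odd Q"
  shows "for_almost_all_odd (\<lambda>n. P n \<and> Q n)"
  unfolding for_almost_all_odd_iff
proof (intro allI impI)
  fix \<epsilon> :: real assume "\<epsilon> > 0"
  then have "\<epsilon> / 2 > 0" by simp
  with assms have "\<forall>\<^sub>F x in at_top. real (card {n. odd n \<and> real n \<le> x \<and> \<not> P n}) \<le> \<epsilon> / 2 * x"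
    "\<forall>\<^sub>F x in at_top. real (card {n. odd n \<and> real n \<le> x \<and> \<not> Q n}) \<le> \<epsilon> / 2 * x"
    unfolding for_almost_all_odd_iff by blast+
  then show "\<forall>\<^sub>F x in at_top. real (card {n. odd n \<and> real n \<le> x \<and> \<not> (P n \<and> Q n)}) \<le> \<epsilon> * x"
  proof eventually_elim
    case (elim x)
    have "card {n. odd n \<and> real n \<le> x \<and> \<not> (P n \<and> Q n)}
        \<le> card ({n. odd n \<and> real n \<le> x \<and> \<not> P n} \<union> {n. odd n \<and> real n \<le> x \<and> \<not> Q n})"
      by (intro card_mono) auto
    also have "\<dots> \<le> card {n. odd n \<and> real n \<le> x \<and> \<not> P n} + card {n. odd n \<and> real n \<le> x \<and> \<not> Q n}"
      by (rule card_Un_le)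
    finally show ?case using elim by linarith
  qed
qed

text \<open>
  A set with few elements in each interval \<open>[x, 2 * x)\<close>, \<open>x\<close> large, has density zero: repeated
  halving of the interval \<open>[0, u)\<close> gives a geometric series of counts, apart from a fixed initial
  segment.
\<close>

lemma for_almost_all_odd_dyadic:
  assumes "\<And>\<epsilon>. \<epsilon> > 0 \<Longrightarrow>
    \<forall>\<^sub>F x in at_top. real (card {n. x \<le> real n \<and> real n < 2 * x \<and> \<not> P n}) \<le> \<epsilon> * x"
  shows "for_almost_all_odd P"
  unfolding for_almost_all_odd_iff
proof (intro allI impI)
  fix \<epsilon> :: real assume \<epsilon>: "\<epsilon> > 0"
  define c where "c u = real (card {n. real n < u \<and> \<not> P n})" for u
  have fin: "finite {n. real n < u \<and> \<not> P n}" for u :: real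
    by (rule finite_subset[OF _ finite_nat_real_le[of u "\<lambda>_. True"]]) auto
  have "\<forall>\<^sub>F x in at_top. real (card {n. x \<le> real n \<and> real n < 2 * x \<and> \<not> P n}) \<le> \<epsilon> / 2 * x"
    using assms[of "\<epsilon> / 2"] \<epsilon> by simp
  then obtain x1 where x1: "\<And>x. x \<ge> x1 \<Longrightarrow>
      real (card {n. x \<le> real n \<and> real n < 2 * x \<and> \<not> P n}) \<le> \<epsilon> / 2 * x"
    unfolding eventually_at_top_linorder by blast
  define x0 where "x0 = max 1 x1"
  have x0: "x0 \<ge> 1" "x0 \<ge> x1" by (auto simp: x0_def)
  have small: "c u \<le> c (2 * x0) + \<epsilon> / 2 * u" if "0 \<le> u" "u < 2 * x0" for u
  proof -
    have "c u \<le> c (2 * x0)"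
      unfolding c_def of_nat_le_iff using that by (intro card_mono fin) auto
    with that \<epsilon> show ?thesis by (smt (verit) mult_nonneg_nonneg divide_nonneg_pos)
  qed
  have bound: "c u \<le> c (2 * x0) + \<epsilon> / 2 * u" if "0 \<le> u" "u < 2 ^ m * (2 * x0)" for u m
    using that
  proof (induction m arbitrary: u)
    case 0
    then show ?case using small by simp
  next
    case (Suc m)
    show ?case
    proof (cases "u < 2 * x0")
      case True
      then show ?thesis using small Suc.prems by simp
    next
      case False
      have "{n. real n < u \<and> \<not> P n} =
          {n. real n < u / 2 \<and> \<not> P n} \<union> {n. u / 2 \<le> real n \<and> real n < 2 * (u / 2) \<and> \<not> P n}"
        using Suc.prems by auto
      then have "c u \<le> c (u / 2) + real (card {n. u / 2 \<le> real n \<and> real n < 2 * (u / 2) \<and> \<not> P n})"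
        unfolding c_def of_nat_add[symmetric] of_nat_le_iff by (simp only: card_Un_le)
      moreover have "real (card {n. u / 2 \<le> real n \<and> real n < 2 * (u / 2) \<and> \<not> P n}) \<le> \<epsilon> / 2 * (u / 2)"
        using False x0 by (intro x1) simp
      moreover have "c (u / 2) \<le> c (2 * x0) + \<epsilon> / 2 * (u / 2)"
        using Suc.prems by (intro Suc.IH) auto
      ultimately show ?thesis by argo
    qed
  qed
  have all: "c u \<le> c (2 * x0) + \<epsilon> / 2 * u" if "0 \<le> u" for u
  proof -
    obtain m where "u / (2 * x0) < 2 ^ m"
      using real_arch_pow[of 2 "u / (2 * x0)"] by auto
    then have "u < 2 ^ m * (2 * x0)" using x0 by (simp add: field_simps)
    with bound that show ?thesis by blast
  qed
  have "\<forall>\<^sub>F x in at_top. c (2 * x0) + \<epsilon> / 2 * (x + 1) \<le> \<epsilon> * x"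
    using \<epsilon> by real_asymp
  with eventually_ge_at_top[of 0]
  show "\<forall>\<^sub>F x in at_top. real (card {n. odd n \<and> real n \<le> x \<and> \<not> P n}) \<le> \<epsilon> * x"
  proof eventually_elim
    case (elim x)
    have "real (card {n. odd n \<and> real n \<le> x \<and> \<not> P n}) \<le> c (x + 1)"
      unfolding c_def of_nat_le_iff by (intro card_mono fin) auto
    with all[of "x + 1"] elim show ?case by linarith
  qed
qed

lemma for_almost_all_odd_eventually:
  assumes "\<forall>\<^sub>F x in at_top. \<forall>n. x \<le> real n \<longrightarrow> P n"
  shows "for_almost_all_odd P"
proof (rule for_almost_all_odd_dyadic)
  fix \<epsilon> :: real assume "\<epsilon> > 0"
  from assms eventually_ge_at_top[of 0]
  show "\<forall>\<^sub>F x in at_top. real (card {n. x \<le> real n \<and> real n < 2 * x \<and> \<not> P n}) \<le> \<epsilon> * x"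
  proof eventually_elim
    case (elim x)
    then have "{n. x \<le> real n \<and> real n < 2 * x \<and> \<not> P n} = {}" by auto
    then have "card {n. x \<le> real n \<and> real n < 2 * x \<and> \<not> P n} = 0" by (metis card.empty)
    with elim \<open>\<epsilon> > 0\<close> show ?case by simp
  qed
qed

section \<open>The trivial upper bound for the Mahler measure of the hypersurface\<close>

lemma prob_space_circle_measure: "prob_space circle_measure"
proof -
  have "prob_space (uniform_measure lborel {0..<1::real})"
    by (rule prob_space_uniform_measure) auto
  moreover have "(\<lambda>t::real. cis (2 * pi * t)) \<in>
      uniform_measure lborel {0..<1} \<rightarrow>\<^sub>M restrict_space borel (sphere 0 1)"
  proof (rule measurable_restrict_space2)
    have "(\<lambda>t::real. cis (2 * pi * t)) \<in> borel_measurable borel"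
      by (intro borel_measurable_continuous_onI continuous_intros)
    then show "(\<lambda>t::real. cis (2 * pi * t)) \<in> borel_measurable (uniform_measure lborel {0..<1})"
      by (simp add: measurable_def)
  qed auto
  ultimately show ?thesis
    unfolding circle_measure_def by (rule prob_space.prob_space_distr)
qed

lemma card_exponents_F_le:
  assumes "k > 0"
  shows "card (exponents_F k) \<le> k" "finite (exponents_F k)"
proof -
  have fin: "finite {z::complex. z ^ k = 1}"
    using assms by (intro finite_roots_unity) simp
  have "card {z::complex. z ^ k = 1} = k" using assms by (rule card_roots_unity_eq)
  then show "card (exponents_F k) \<le> k"
    unfolding exponents_F_def using card_image_le[OF fin] by metis
  show "finite (exponents_F k)" unfolding exponents_F_def using fin by simp
qed

text \<open>
  The integrand is bounded pointwise by \<open>ln (k + 1)\<close> on a probability space. If it were not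
  integrable, the integral would be \<open>0\<close> by convention, and the bound would hold as well.
\<close>

lemma log_mahler_C_le:
  assumes "k > 0"
  shows "log_mahler_C k \<le> ln (real k + 1)"
proof -
  interpret prob_space "torus_measure (totient k)"
    unfolding torus_measure_def by (intro prob_space_PiM prob_space_circle_measure)
  have pt: "ln (norm (x 0 + eval_F k x)) \<le> ln (real k + 1)"
    if x: "x \<in> space (torus_measure (totient k))" for x
  proof -
    have nx: "norm (x i) = 1" if "i \<le> totient k" for i
    proof -
      have "x i \<in> space circle_measure"
        using x that unfolding torus_measure_def by (auto simp: space_PiM)
      then show ?thesis by (simp add: circle_measure_def space_restrict_space)
    qed
    have "norm (eval_F k x) \<le> (\<Sum>a\<in>exponents_F k. 1)"
      unfolding eval_F_def
      by (rule sum_norm_le) (simp add: prod_norm[symmetric] norm_power_int nx)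
    also have "\<dots> \<le> real k" using card_exponents_F_le[OF assms] by simp
    finally have "norm (x 0 + eval_F k x) \<le> real k + 1"
      using norm_triangle_ineq[of "x 0" "eval_F k x"] nx[of 0] by simp
    then show ?thesis
      by (cases "x 0 + eval_F k x = 0") (auto intro: ln_mono)
  qed
  show ?thesis
  proof (cases "integrable (torus_measure (totient k)) (\<lambda>x. ln (norm (x 0 + eval_F k x)))")
    case True
    then show ?thesis
      unfolding log_mahler_C_def using pt by (intro integral_le_const) auto
  next
    case False
    then show ?thesis unfolding log_mahler_C_def by (simp add: not_integrable_integral_eq)
  qed
qed

section \<open>Singular series for one and two linear forms\<close>

definition local_factor :: "(nat \<Rightarrow> nat) \<Rightarrow> nat \<Rightarrow> nat \<Rightarrow> real" where
  "local_factor r l p =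
     (if prime p then (1 - real (num_solutions r l p) / real p) / (1 - 1 / real p) ^ l else 1)"

lemma singular_series_eq: "singular_series r l = (\<Prod>p. local_factor r l p)"
  unfolding singular_series_def local_factor_def ..

text \<open>The coefficients of the forms \<open>q * a + 1\<close> and \<open>q * b + 1\<close>, with indices \<open>1\<close> and \<open>2\<close>.\<close>

definition pair :: "nat \<Rightarrow> nat \<Rightarrow> nat \<Rightarrow> nat" where
  "pair a b = (\<lambda>i. if i = 1 then a else b)"

definition roots_mod :: "nat \<Rightarrow> nat \<Rightarrow> nat set" where
  "roots_mod k p = {q. q < p \<and> p dvd q * k + 1}"

lemma finite_roots_mod [simp]: "finite (roots_mod k p)"
  by (simp add: roots_mod_def)

lemma roots_mod_eq_empty:
  assumes "prime p" "p dvd k"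
  shows "roots_mod k p = {}"
proof -
  have "\<not> p dvd q * k + 1" for q
  proof
    assume "p dvd q * k + 1"
    moreover have "p dvd q * k" using assms(2) by simp
    ultimately have "p dvd 1" by (simp only: dvd_add_right_iff)
    with assms(1) show False using not_prime_unit by blast
  qed
  then show ?thesis by (simp add: roots_mod_def)
qed

lemma card_roots_mod:
  assumes p: "prime p" "\<not> p dvd k"
  shows "card (roots_mod k p) = 1"
proof -
  have cop: "coprime k p" using p by (metis coprime_commute prime_imp_coprime)
  then obtain x where x: "[k * x = 1] (mod p)" using cong_solve_coprime_nat by auto
  define q where "q = (p - 1) * x mod p"
  have p1: "p \<ge> 1" using p(1) by (rule prime_ge_1_nat)
  have "[q * k + 1 = (p - 1) * x * k + 1] (mod p)"
    unfolding q_def by (intro cong_add cong_mult) (auto simp: unique_euclidean_semiring_class.cong_def)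
  also have "(p - 1) * x * k + 1 = (p - 1) * (k * x) + 1" by (simp add: mult_ac)
  also have "[\<dots> = (p - 1) * 1 + 1] (mod p)" using x by (intro cong_add cong_mult) auto
  also have "(p - 1) * 1 + 1 = p" using p1 by simp
  also have "[p = 0] (mod p)" by (simp add: unique_euclidean_semiring_class.cong_def)
  finally have q: "q \<in> roots_mod k p"
    using p1 by (auto simp: roots_mod_def q_def cong_0_iff)
  have "q' = q" if "q' \<in> roots_mod k p" for q'
  proof -
    have "[q' * k + 1 = q * k + 1] (mod p)"
      using that q unfolding roots_mod_def
      by (simp only: mem_Collect_eq unique_euclidean_semiring_class.cong_def dvd_imp_mod_0)
    then have "[q' * k = q * k] (mod p)" by (simp only: cong_add_rcancel_nat)
    then have "[q' = q] (mod p)" using cop by (simp add: cong_mult_rcancel_nat)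
    then show ?thesis
      using that q by (auto simp: roots_mod_def intro: cong_less_modulus_unique_nat)
  qed
  with q have "roots_mod k p = {q}" by blast
  then show ?thesis by simp
qed

lemma roots_mod_cong: "[a = b] (mod p) \<Longrightarrow> roots_mod a p = roots_mod b p"
proof -
  assume "[a = b] (mod p)"
  then have "[q * a + 1 = q * b + 1] (mod p)" for q by (intro cong_add cong_mult) auto
  then have "p dvd q * a + 1 \<longleftrightarrow> p dvd q * b + 1" for q by (metis cong_dvd_iff)
  then show ?thesis by (simp add: roots_mod_def)
qed

lemma roots_mod_disjoint:
  assumes p: "prime p" and "\<not> [a = b] (mod p)"
  shows "roots_mod a p \<inter> roots_mod b p = {}"
proof (rule ccontr)
  assume "\<not> ?thesis"
  then obtain q where q: "p dvd q * a + 1" "p dvd q * b + 1" by (auto simp: roots_mod_def)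
  then have "[q * a + 1 = q * b + 1] (mod p)" by (simp only: unique_euclidean_semiring_class.cong_def dvd_imp_mod_0)
  then have "[q * a = q * b] (mod p)" by (simp only: cong_add_rcancel_nat)
  moreover have "\<not> p dvd q"
  proof
    assume "p dvd q"
    then have "p dvd q * a" by simp
    with q(1) have "p dvd 1" by (simp only: dvd_add_right_iff)
    with p show False using not_prime_unit by blast
  qed
  then have "coprime q p" using p by (metis coprime_commute prime_imp_coprime)
  ultimately have "[a = b] (mod p)" by (simp add: cong_mult_lcancel_nat)
  with assms show False by simp
qed

lemma num_solutions_single: "num_solutions (\<lambda>_. k) 1 p = card (roots_mod k p)"
  by (simp add: num_solutions_def roots_mod_def)

lemma num_solutions_pair:
  assumes "prime p"
  shows "num_solutions (pair a b) 2 p = card (roots_mod a p \<union> roots_mod b p)"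
proof -
  have "(\<Prod>j\<in>{1..2}. q * pair a b j + 1) = (q * a + 1) * (q * b + 1)" for q
    by (simp add: pair_def numeral_2_eq_2)
  then have "{q. q < p \<and> p dvd (\<Prod>j\<in>{1..2}. q * pair a b j + 1)} = roots_mod a p \<union> roots_mod b p"
    unfolding roots_mod_def by (simp only: prime_dvd_mult_iff[OF assms]) blast
  then show ?thesis by (simp add: num_solutions_def)
qed

lemma local_factor_single:
  "local_factor (\<lambda>_. k) 1 p = (if prime p \<and> p dvd k then 1 + 1 / (real p - 1) else 1)"
proof (cases "prime p")
  case True
  then have "real p > 1" by (simp add: prime_gt_Suc_0_nat)
  with True show ?thesis
    by (auto simp: local_factor_def num_solutions_single[unfolded One_nat_def] roots_mod_eq_empty card_roots_mod field_simps)
next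
  case False
  then show ?thesis by (simp add: local_factor_def)
qed

text \<open>
  The local factors of two forms, as functions of the prime \<open>u\<close>, when the two forms have together
  \<open>0\<close>, \<open>1\<close> or \<open>2\<close> roots modulo \<open>u\<close>.
\<close>

lemma euler_ratio_0:
  fixes u :: real
  assumes "1 < u"
  shows "1 / (1 - 1 / u)\<^sup>2 = (1 + 1 / (u - 1)) * (1 + 1 / (u - 1))"
proof -
  have "1 / (1 - 1 / u) = 1 + 1 / (u - 1)" using assms by (simp add: field_simps)
  then show ?thesis by (metis power2_eq_square power_one_over)
qed

lemma euler_ratio_1:
  fixes u :: real
  assumes "1 < u"
  shows "(1 - 1 / u) / (1 - 1 / u)\<^sup>2 = 1 + 1 / (u - 1)"
proof -
  have "1 - 1 / u \<noteq> 0" using assms by (simp add: field_simps)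
  then have "(1 - 1 / u) / (1 - 1 / u)\<^sup>2 = 1 / (1 - 1 / u)" by (simp add: power2_eq_square)
  also have "\<dots> = 1 + 1 / (u - 1)" using assms by (simp add: field_simps)
  finally show ?thesis .
qed

lemma euler_ratio_2:
  fixes u :: real
  assumes "1 < u"
  shows "(1 - 2 / u) / (1 - 1 / u)\<^sup>2 = 1 - 1 / (u - 1)\<^sup>2"
proof -
  have "1 - 1 / u = (u - 1) / u" using assms by (simp add: field_simps)
  then show ?thesis
    using assms by (simp add: divide_simps) (simp add: power2_eq_square algebra_simps)
qed

text \<open>
  The two conditions "\<open>q * a + 1\<close> is prime to \<open>p\<close>" and "\<open>q * b + 1\<close> is prime to \<open>p\<close>" on \<open>q\<close> are
  independent as soon as one of them is void; otherwise they are positively correlated if they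
  coincide and slightly negatively correlated if they exclude different residue classes.
\<close>

lemma local_factor_pair:
  assumes p: "prime p"
  shows "local_factor (pair a b) 2 p =
    local_factor (\<lambda>_. a) 1 p * local_factor (\<lambda>_. b) 1 p *
      (if p dvd a \<or> p dvd b then 1
       else if [a = b] (mod p) then 1 + 1 / (real p - 1) else 1 - 1 / (real p - 1) ^ 2)"
proof -
  have P: "real p > 1" using p by (simp add: prime_gt_Suc_0_nat)
  consider "p dvd a" "p dvd b" | "p dvd a" "\<not> p dvd b" | "\<not> p dvd a" "p dvd b"
    | "\<not> p dvd a" "\<not> p dvd b" "[a = b] (mod p)" | "\<not> p dvd a" "\<not> p dvd b" "\<not> [a = b] (mod p)"
    by blast
  then show ?thesis
  proof cases
    case 4
    with p have "num_solutions (pair a b) 2 p = 1"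
      by (simp add: num_solutions_pair roots_mod_cong card_roots_mod)
    with 4 p P show ?thesis
      unfolding local_factor_single by (simp add: local_factor_def euler_ratio_1)
  next
    case 5
    with p have "num_solutions (pair a b) 2 p = 2"
      by (simp add: num_solutions_pair card_Un_disjoint roots_mod_disjoint card_roots_mod)
    with 5 p P show ?thesis
      unfolding local_factor_single by (simp add: local_factor_def euler_ratio_2)
  qed (use p P in \<open>simp_all only: local_factor_single,
        simp_all add: local_factor_def num_solutions_pair roots_mod_eq_empty card_roots_mod
          euler_ratio_1 euler_ratio_0\<close>)
qed

lemma local_factor_single_ge_1: "1 \<le> local_factor (\<lambda>_. k) 1 p"
  unfolding local_factor_single by (auto dest: prime_gt_1_nat)

lemma convergent_prod_local_factor_single:
  assumes "k > 0"
  shows "convergent_prod (local_factor (\<lambda>_. k) 1)"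
proof (rule convergent_prod_finite)
  show "finite {..k}" by simp
  fix p assume "p \<notin> {..k}"
  with assms show "local_factor (\<lambda>_. k) 1 p = 1"
    unfolding local_factor_single by (auto dest: dvd_imp_le)
qed

lemma singular_series_single_ge_1:
  assumes "k > 0"
  shows "1 \<le> singular_series (\<lambda>_. k) 1"
  unfolding singular_series_eq
proof (rule LIMSEQ_le_const)
  show "(\<lambda>n. \<Prod>i\<le>n. local_factor (\<lambda>_. k) 1 i) \<longlonglongrightarrow> (\<Prod>p. local_factor (\<lambda>_. k) 1 p)"
    by (intro convergent_prod_LIMSEQ convergent_prod_local_factor_single assms)
  show "\<exists>N. \<forall>n\<ge>N. 1 \<le> (\<Prod>i\<le>n. local_factor (\<lambda>_. k) 1 i)"
    by (intro exI allI impI prod_ge_1 local_factor_single_ge_1)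
qed

text \<open>
  The product of \<open>p / (p - 1)\<close> over the primes dividing \<open>k\<close> is at most the telescoping product of
  \<open>i / (i - 1)\<close> over all \<open>i\<close> with \<open>2 \<le> i \<le> k\<close>.
\<close>

lemma singular_series_single_le:
  assumes "k > 0"
  shows "singular_series (\<lambda>_. k) 1 \<le> real k"
  unfolding singular_series_eq
proof (rule LIMSEQ_le_const2)
  show "(\<lambda>n. \<Prod>i\<le>n. local_factor (\<lambda>_. k) 1 i) \<longlonglongrightarrow> (\<Prod>p. local_factor (\<lambda>_. k) 1 p)"
    by (intro convergent_prod_LIMSEQ convergent_prod_local_factor_single assms)
  have "(\<Prod>i\<le>n. local_factor (\<lambda>_. k) 1 i) \<le> real (max 1 (min n k))" for n
  proof (induction n)
    case 0
    then show ?case by (simp add: local_factor_def)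
  next
    case (Suc n)
    have *: "local_factor (\<lambda>_. k) 1 (Suc n) \<le> real (max 1 (min (Suc n) k)) / real (max 1 (min n k))"
    proof (cases "prime (Suc n) \<and> Suc n dvd k")
      case True
      then have "Suc n \<le> k" "n \<ge> 1"
        using assms dvd_imp_le prime_gt_1_nat[of "Suc n"] by auto
      with True show ?thesis
        unfolding local_factor_single by (simp add: min_def max_def field_simps)
    next
      case False
      then show ?thesis unfolding local_factor_single by (auto simp: field_simps)
    qed
    have "(\<Prod>i\<le>Suc n. local_factor (\<lambda>_. k) 1 i) \<le>
        real (max 1 (min n k)) * (real (max 1 (min (Suc n) k)) / real (max 1 (min n k)))"
      unfolding prod.atMost_Suc
      using Suc.IH * local_factor_single_ge_1[of k "Suc n"] by (intro mult_mono) auto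
    then show ?case by simp
  qed
  also have "real (max 1 (min n k)) \<le> real k" for n using assms by simp
  finally show "\<exists>N. \<forall>n\<ge>N. (\<Prod>i\<le>n. local_factor (\<lambda>_. k) 1 i) \<le> real k" by blast
qed

text \<open>
  For all large primes the local factor is \<open>1 - 1 / (p - 1)\<^sup>2\<close>. Convergence has to be established
  because the value of a divergent infinite product is arbitrary.
\<close>

lemma convergent_prod_local_factor_pair:
  assumes "a > 0" "b > 0" "a \<noteq> b"
  shows "convergent_prod (local_factor (pair a b) 2)"
proof (rule abs_convergent_prod_imp_convergent_prod)
  have "norm (local_factor (pair a b) 2 p - 1) \<le> 4 * (1 / real p ^ 2)" if "p \<ge> a + b + 2" for p
  proof (cases "prime p")
    case True
    have "\<not> p dvd a" "\<not> p dvd b" using assms that by (auto dest!: dvd_imp_le)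
    moreover have "\<not> [a = b] (mod p)"
      using assms that cong_less_modulus_unique_nat[of a b p] by auto
    ultimately have "norm (local_factor (pair a b) 2 p - 1) = 1 / (real p - 1) ^ 2"
      unfolding local_factor_pair[OF True] local_factor_single by simp
    also have "\<dots> \<le> 1 / (real p / 2) ^ 2"
      using that by (intro divide_left_mono power_mono mult_pos_pos) auto
    finally show ?thesis by (simp add: power_divide)
  next
    case False
    then show ?thesis by (simp add: local_factor_def)
  qed
  moreover have "summable (\<lambda>p. 4 * (1 / real p ^ 2))"
    by (intro summable_mult inverse_power_summable[of 2, unfolded inverse_eq_divide]) simp
  ultimately show "abs_convergent_prod (local_factor (pair a b) 2)"
    unfolding abs_convergent_prod_conv_summable
    by (intro summable_comparison_test[OF _ \<open>summable _\<close>] exI[of _ "a + b + 2"]) auto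
qed

text \<open>
  Only primes at which the two forms are positively correlated raise the singular series above the
  product of those for the single forms. Allowing any finite superset \<open>D\<close> of these primes leaves
  room to describe them conveniently.
\<close>

lemma singular_series_pair_le:
  assumes "a > 0" "b > 0" "a \<noteq> b"
    and D: "finite D" "\<And>p. prime p \<Longrightarrow> \<not> p dvd a \<Longrightarrow> [a = b] (mod p) \<Longrightarrow> p \<in> D"
      "\<And>p. p \<in> D \<Longrightarrow> p > 1"
  shows "singular_series (pair a b) 2 \<le>
    singular_series (\<lambda>_. a) 1 * singular_series (\<lambda>_. b) 1 * (\<Prod>p\<in>D. 1 + 1 / (real p - 1))"
  unfolding singular_series_eq
proof (rule LIMSEQ_le)
  show "(\<lambda>n. \<Prod>i\<le>n. local_factor (pair a b) 2 i) \<longlonglongrightarrow> (\<Prod>p. local_factor (pair a b) 2 p)"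
    by (intro convergent_prod_LIMSEQ convergent_prod_local_factor_pair assms)
  show "(\<lambda>n. (\<Prod>i\<le>n. local_factor (\<lambda>_. a) 1 i) * (\<Prod>i\<le>n. local_factor (\<lambda>_. b) 1 i) *
      (\<Prod>p\<in>D. 1 + 1 / (real p - 1))) \<longlonglongrightarrow>
      (\<Prod>p. local_factor (\<lambda>_. a) 1 p) * (\<Prod>p. local_factor (\<lambda>_. b) 1 p) *
      (\<Prod>p\<in>D. 1 + 1 / (real p - 1))"
    by (intro tendsto_intros convergent_prod_LIMSEQ convergent_prod_local_factor_single assms)
  let ?f = "\<lambda>i. local_factor (\<lambda>_. a) 1 i * local_factor (\<lambda>_. b) 1 i"
  let ?g = "\<lambda>i. if i \<in> D then 1 + 1 / (real i - 1) else 1"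
  have g1: "1 \<le> ?g i" for i using D(3)[of i] by auto
  have f1: "0 \<le> ?f i" for i
    using local_factor_single_ge_1[of a i] local_factor_single_ge_1[of b i] by (intro mult_nonneg_nonneg) linarith+
  have "0 \<le> local_factor (pair a b) 2 i \<and> local_factor (pair a b) 2 i \<le> ?f i * ?g i" for i
  proof (cases "prime i")
    case True
    let ?h = "if i dvd a \<or> i dvd b then 1
       else if [a = b] (mod i) then 1 + 1 / (real i - 1) else 1 - 1 / (real i - 1) ^ 2"
    have "0 \<le> ?h \<and> ?h \<le> ?g i"
    proof -
      have "1 \<le> (real i - 1) ^ 2"
        using prime_ge_2_nat[OF True] by (intro one_le_power) simp
      then have "1 / (real i - 1) ^ 2 \<le> 1" "0 \<le> 1 / (real i - 1) ^ 2" by (simp_all add: divide_le_eq)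
      then have off: "0 \<le> 1 - 1 / (real i - 1) ^ 2" "1 - 1 / (real i - 1) ^ 2 \<le> ?g i"
        using g1[of i] by linarith+
      consider "i dvd a \<or> i dvd b" | "\<not> i dvd a" "\<not> i dvd b" "[a = b] (mod i)"
        | "\<not> i dvd a" "\<not> i dvd b" "\<not> [a = b] (mod i)" by blast
      then show ?thesis
      proof cases
        case 1
        then have "?h = 1" by simp
        with g1[of i] show ?thesis by linarith
      next
        case 2
        then have "?h = ?g i" using D(2)[OF True] by simp
        with g1[of i] show ?thesis by linarith
      next
        case 3
        then have "?h = 1 - 1 / (real i - 1) ^ 2" by simp
        with off show ?thesis by linarith
      qed
    qed
    then show ?thesis
      unfolding local_factor_pair[OF True] using mult_nonneg_nonneg[OF f1[of i], of ?h]
        mult_left_mono[OF _ f1[of i], of ?h "?g i"] by blast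
  next
    case False
    then show ?thesis using g1[of i] by (simp add: local_factor_def)
  qed
  then have "(\<Prod>i\<le>n. local_factor (pair a b) 2 i) \<le> (\<Prod>i\<le>n. ?f i * ?g i)" for n
    by (intro prod_mono) auto
  also have "(\<Prod>i\<le>n. ?f i * ?g i) = (\<Prod>i\<le>n. ?f i) * (\<Prod>i\<le>n. ?g i)" for n
    by (rule prod.distrib)
  also have "(\<Prod>i\<le>n. ?f i) * (\<Prod>i\<le>n. ?g i) \<le> (\<Prod>i\<le>n. ?f i) * (\<Prod>p\<in>D. 1 + 1 / (real p - 1))" for n
  proof (rule mult_left_mono)
    have "(\<Prod>i\<le>n. ?g i) = (\<Prod>i\<in>{..n} \<inter> D. 1 + 1 / (real i - 1))"
      by (simp add: prod.inter_restrict)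
    also have "\<dots> \<le> (\<Prod>p\<in>D. 1 + 1 / (real p - 1))"
      using D by (intro prod_mono2) (auto dest!: D(3))
    finally show "(\<Prod>i\<le>n. ?g i) \<le> (\<Prod>p\<in>D. 1 + 1 / (real p - 1))" .
    show "0 \<le> (\<Prod>i\<le>n. ?f i)" using f1 by (intro prod_nonneg) blast
  qed
  finally show "\<exists>N. \<forall>n\<ge>N. (\<Prod>i\<le>n. local_factor (pair a b) 2 i) \<le>
      (\<Prod>i\<le>n. local_factor (\<lambda>_. a) 1 i) * (\<Prod>i\<le>n. local_factor (\<lambda>_. b) 1 i) *
      (\<Prod>p\<in>D. 1 + 1 / (real p - 1))"
    unfolding prod.distrib by blast
qed

section \<open>Large prime factors of differences\<close>

definition rough_primes :: "nat \<Rightarrow> nat \<Rightarrow> nat set" where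
  "rough_primes y h = {p. prime p \<and> y < p \<and> p dvd h}"

definition divisor_tail :: "nat \<Rightarrow> nat \<Rightarrow> real" where
  "divisor_tail y h = (\<Sum>d | d dvd h \<and> y < d. 1 / sqrt (real d))"

lemma divisor_tail_nonneg: "0 \<le> divisor_tail y h"
  unfolding divisor_tail_def by (intro sum_nonneg) simp

lemma finite_rough_primes:
  assumes "h > 0"
  shows "finite (rough_primes y h)"
  by (rule finite_subset[of _ "{..h}"]) (use assms in \<open>auto simp: rough_primes_def dest: dvd_imp_le\<close>)

lemma prod_distinct_primes_dvd:
  fixes h :: nat
  assumes "finite B" "\<And>p. p \<in> B \<Longrightarrow> prime p \<and> p dvd h"
  shows "\<Prod>B dvd h"
  using assms
proof (induction B rule: finite_induct)
  case (insert p B)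
  have "coprime p q" if "q \<in> B" for q
    using insert.hyps insert.prems that by (intro primes_coprime) auto
  then have "coprime p (\<Prod>B)" by (intro prod_coprime_right) auto
  with insert show ?case by (simp add: divides_mult)
qed simp

lemma inj_on_prod_primes:
  assumes "finite A" "\<And>p. p \<in> A \<Longrightarrow> prime (p :: nat)"
  shows "inj_on (\<lambda>B. \<Prod>B) (Pow A)"
proof (rule inj_onI)
  have mem: "p \<in> B \<longleftrightarrow> p dvd \<Prod>B" if "B \<subseteq> A" "p \<in> A" for B p
  proof -
    have "finite B" using that(1) assms(1) by (rule finite_subset)
    then have "p dvd \<Prod>B \<longleftrightarrow> (\<exists>q\<in>B. p dvd q)"
      using prime_dvd_prod_iff[of B p "\<lambda>q. q"] assms(2)[OF that(2)] by simp
    moreover have "p dvd q \<longleftrightarrow> p = q" if "q \<in> B" for q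
      using assms(2)[of p] assms(2)[of q] \<open>p \<in> A\<close> \<open>B \<subseteq> A\<close> that primes_dvd_imp_eq[of p q] by auto
    ultimately show ?thesis by auto
  qed
  fix B C assume "B \<in> Pow A" "C \<in> Pow A" "\<Prod>B = \<Prod>C"
  moreover from this have "p \<in> B \<longleftrightarrow> p \<in> C" if "p \<in> A" for p
    using mem[of B p] mem[of C p] that by simp
  ultimately show "B = C" by blast
qed

text \<open>
  Expand the product: each nonempty set \<open>B\<close> of primes in it contributes \<open>1 / (p - 1)\<close> multiplied
  over \<open>p \<in> B\<close>. Since \<open>p \<ge> 3\<close>, one has \<open>p - 1 \<ge> sqrt p\<close>, so the contribution is at most
  \<open>1 / sqrt d\<close> for the divisor \<open>d = \<Prod>B\<close> of \<open>h\<close>. Distinct sets give distinct \<open>d\<close>, and \<open>d > y\<close>.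
\<close>

lemma rough_product_le:
  assumes h: "h > 0" and y: "y \<ge> 2"
  shows "(\<Prod>p\<in>rough_primes y h. 1 + 1 / (real p - 1)) \<le> 1 + divisor_tail y h"
proof -
  define A where "A = rough_primes y h"
  have A: "prime p" "y < p" "p dvd h" if "p \<in> A" for p
    using that by (auto simp: A_def rough_primes_def)
  have fin: "finite A" unfolding A_def using h by (rule finite_rough_primes)
  have fin_sub: "finite B" if "B \<subseteq> A" for B using that fin by (rule finite_subset)
  have weight: "(\<Prod>p\<in>B. 1 / (real p - 1)) \<le> 1 / sqrt (real (\<Prod>B))" if B: "B \<subseteq> A" for B
  proof -
    have "1 / (real p - 1) \<le> 1 / sqrt (real p)" if "p \<in> B" for p
    proof -
      have p: "real p \<ge> 3" using that B A(2)[of p] y by auto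
      then have "3 * real p \<le> real p * real p" by (intro mult_right_mono) auto
      then have "real p \<le> (real p - 1) ^ 2" by (simp add: power2_eq_square algebra_simps)
      then have "sqrt (real p) \<le> real p - 1" using p by (intro real_le_lsqrt) auto
      with p show ?thesis by (intro divide_left_mono mult_pos_pos) auto
    qed
    moreover have "0 \<le> 1 / (real p - 1)" if "p \<in> B" for p
      using that B A(2)[of p] y by auto
    ultimately have "(\<Prod>p\<in>B. 1 / (real p - 1)) \<le> (\<Prod>p\<in>B. 1 / sqrt (real p))"
      by (intro prod_mono) auto
    also have "\<dots> = 1 / sqrt (real (\<Prod>B))"
      using fin_sub[OF B] by (induction B rule: finite_induct) (auto simp: real_sqrt_mult)
    finally show ?thesis .
  qed
  have "(\<Prod>p\<in>A. 1 / (real p - 1) + 1) = (\<Sum>B\<in>Pow A. \<Prod>p\<in>B. 1 / (real p - 1))"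
    using prod_add[OF fin, of "\<lambda>p. 1 / (real p - 1)" "\<lambda>_. 1"] by simp
  also have "\<dots> = 1 + (\<Sum>B\<in>Pow A - {{}}. \<Prod>p\<in>B. 1 / (real p - 1))"
    using fin by (subst sum.remove[of _ "{}"]) auto
  also have "(\<Sum>B\<in>Pow A - {{}}. \<Prod>p\<in>B. 1 / (real p - 1))
      \<le> (\<Sum>B\<in>Pow A - {{}}. 1 / sqrt (real (\<Prod>B)))"
    using weight by (intro sum_mono) auto
  also have "\<dots> = (\<Sum>d\<in>(\<lambda>B. \<Prod>B) ` (Pow A - {{}}). 1 / sqrt (real d))"
    using inj_on_subset[OF inj_on_prod_primes[of A]] fin A(1)
    by (subst sum.reindex) auto
  also have "\<dots> \<le> divisor_tail y h"
    unfolding divisor_tail_def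
  proof (intro sum_mono2 subsetI)
    show "finite {d. d dvd h \<and> y < d}" using h by simp
    fix d assume "d \<in> (\<lambda>B. \<Prod>B) ` (Pow A - {{}})"
    then obtain B where B: "B \<subseteq> A" "B \<noteq> {}" "d = \<Prod>B" by auto
    have dvd: "d dvd h"
      unfolding B(3) using B(1) A by (intro prod_distinct_primes_dvd fin_sub) auto
    obtain p where p: "p \<in> B" using B(2) by blast
    then have "p dvd d"
      unfolding B(3) using fin_sub[OF B(1)] dvd_prodI[of B p "\<lambda>x. x"] by simp
    moreover have "d > 0" using dvd h by (rule dvd_pos_nat[rotated])
    ultimately have "p \<le> d" by (rule dvd_imp_le)
    moreover have "y < p" using p B(1) A(2) by blast
    ultimately show "d \<in> {d. d dvd h \<and> y < d}" using dvd by simp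
  qed auto
  finally show ?thesis by (simp add: A_def add.commute)
qed

lemma card_multiples_le: "card {h \<in> {1..n}. d dvd h} \<le> n div d"
proof -
  have "{h \<in> {1..n}. d dvd h} \<subseteq> (\<lambda>i. d * i) ` {1..n div d}"
  proof
    fix h assume "h \<in> {h \<in> {1..n}. d dvd h}"
    then obtain i where i: "h = d * i" "1 \<le> h" "h \<le> n" by auto
    then have "d > 0" "i \<ge> 1" by (auto simp: Suc_le_eq)
    moreover from this i have "i \<le> n div d" by (simp add: less_eq_div_iff_mult_less_eq mult.commute)
    ultimately show "h \<in> (\<lambda>i. d * i) ` {1..n div d}" using i by auto
  qed
  then have "card {h \<in> {1..n}. d dvd h} \<le> card ((\<lambda>i. d * i) ` {1..n div d})"
    by (intro card_mono) auto
  also have "\<dots> \<le> n div d" using card_image_le[of "{1..n div d}" "\<lambda>i. d * i"] by simp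
  finally show ?thesis .
qed

text \<open>
  Each \<open>d\<close> divides at most \<open>n / d\<close> of the numbers up to \<open>n\<close>.
\<close>

lemma sum_divisor_tail_le:
  "(\<Sum>h\<in>{1..n}. divisor_tail y h) \<le> real n * (\<Sum>d\<in>{y<..n}. 1 / (real d * sqrt (real d)))"
proof -
  have "divisor_tail y h = (\<Sum>d\<in>{y<..n}. if d dvd h then 1 / sqrt (real d) else 0)"
    if "h \<in> {1..n}" for h
  proof -
    have "{d. d dvd h \<and> y < d} = {d \<in> {y<..n}. d dvd h}"
      using that by (auto dest: dvd_imp_le)
    then show ?thesis unfolding divisor_tail_def by (simp only: sum.inter_filter finite_greaterThanAtMost)
  qed
  then have "(\<Sum>h\<in>{1..n}. divisor_tail y h) =
      (\<Sum>h\<in>{1..n}. \<Sum>d\<in>{y<..n}. if d dvd h then 1 / sqrt (real d) else 0)"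
    by (rule sum.cong[OF refl])
  also have "\<dots> = (\<Sum>d\<in>{y<..n}. \<Sum>h\<in>{1..n}. if d dvd h then 1 / sqrt (real d) else 0)"
    by (rule sum.swap)
  also have "\<dots> = (\<Sum>d\<in>{y<..n}. real (card {h \<in> {1..n}. d dvd h}) / sqrt (real d))"
    by (simp add: sum.inter_filter[symmetric])
  also have "\<dots> \<le> (\<Sum>d\<in>{y<..n}. (real n / real d) / sqrt (real d))"
  proof (intro sum_mono divide_right_mono)
    fix d
    have "real (card {h \<in> {1..n}. d dvd h}) \<le> real (n div d)"
      using card_multiples_le by simp
    also have "\<dots> \<le> real n / real d" by (rule of_nat_div_le_of_nat)
    finally show "real (card {h \<in> {1..n}. d dvd h}) \<le> real n / real d" .
  qed simp
  finally show ?thesis by (simp add: sum_distrib_left)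
qed

lemma tail_three_halves_small:
  assumes "\<tau> > 0"
  shows "\<exists>y\<ge>2. \<forall>n. (\<Sum>d\<in>{y<..n}. 1 / (real d * sqrt (real d))) \<le> \<tau>"
proof -
  have eq: "real d powr (- 3 / 2) = 1 / (real d * sqrt (real d))" for d
  proof (cases "d = 0")
    case False
    have "real d powr (3 / 2) = real d powr 1 * real d powr (1 / 2)"
      unfolding powr_add[symmetric] by simp
    with False show ?thesis by (simp add: powr_minus_divide powr_half_sqrt)
  qed simp
  have "summable (\<lambda>d. real d powr (- 3 / 2))" by (simp add: summable_real_powr_iff)
  then obtain k where k: "\<And>m n. m \<ge> k \<Longrightarrow> norm (\<Sum>d\<in>{m..<n}. real d powr (- 3 / 2)) < \<tau>"
    unfolding summable_Cauchy using assms by meson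
  have "(\<Sum>d\<in>{max 2 k<..n}. 1 / (real d * sqrt (real d))) \<le> \<tau>" for n
  proof -
    have "{max 2 k<..n} = {Suc (max 2 k)..<Suc n}" by auto
    moreover have "norm (\<Sum>d\<in>{Suc (max 2 k)..<Suc n}. real d powr (- 3 / 2)) < \<tau>"
      by (rule k) simp
    then have "(\<Sum>d\<in>{Suc (max 2 k)..<Suc n}. real d powr (- 3 / 2)) \<le> \<tau>"
      unfolding real_norm_def by linarith
    ultimately show ?thesis by (simp only: eq)
  qed
  then show ?thesis by (intro exI[of _ "max 2 k"]) auto
qed

lemma sum_off_diagonal_le:
  fixes s :: "nat \<Rightarrow> real"
  assumes s: "\<And>h. 0 \<le> s h" and i: "i \<in> {1..n}"
  shows "(\<Sum>j\<in>{1..n} - {i}. s (nat \<bar>int i - int j\<bar>)) \<le> 2 * (\<Sum>h\<in>{1..n}. s h)"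
proof -
  have "(\<Sum>j\<in>{1..<i}. s (nat \<bar>int i - int j\<bar>)) = (\<Sum>h\<in>(\<lambda>j. i - j) ` {1..<i}. s h)"
    by (subst sum.reindex) (auto simp: inj_on_def nat_diff_distrib' of_nat_diff intro!: sum.cong arg_cong[of _ _ s])
  also have "\<dots> \<le> (\<Sum>h\<in>{1..n}. s h)" using i s by (intro sum_mono2) auto
  finally have below: "(\<Sum>j\<in>{1..<i}. s (nat \<bar>int i - int j\<bar>)) \<le> (\<Sum>h\<in>{1..n}. s h)" .
  have "(\<Sum>j\<in>{i<..n}. s (nat \<bar>int i - int j\<bar>)) = (\<Sum>h\<in>(\<lambda>j. j - i) ` {i<..n}. s h)"
    by (subst sum.reindex) (auto simp: inj_on_def intro!: sum.cong arg_cong[of _ _ s])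
  also have "\<dots> \<le> (\<Sum>h\<in>{1..n}. s h)" using i s by (intro sum_mono2) auto
  finally have above: "(\<Sum>j\<in>{i<..n}. s (nat \<bar>int i - int j\<bar>)) \<le> (\<Sum>h\<in>{1..n}. s h)" .
  have split: "{1..n} - {i} = {1..<i} \<union> {i<..n}" using i by auto
  have "(\<Sum>j\<in>{1..n} - {i}. s (nat \<bar>int i - int j\<bar>)) =
      (\<Sum>j\<in>{1..<i}. s (nat \<bar>int i - int j\<bar>)) + (\<Sum>j\<in>{i<..n}. s (nat \<bar>int i - int j\<bar>))"
    unfolding split by (rule sum.union_disjoint) auto
  with below above show ?thesis by linarith
qed

text \<open>
  A prime at which \<open>q * (fact y * i) + 1\<close> and \<open>q * (fact y * j) + 1\<close> are positively correlated does
  not divide \<open>fact y\<close>, hence exceeds \<open>y\<close>, and it divides \<open>i - j\<close>. This is the reason to restrict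
  to multiples of \<open>fact y\<close>.
\<close>

lemma singular_series_multiples_le:
  assumes y: "y \<ge> 2" and ij: "i > 0" "j > 0" "i \<noteq> j"
  shows "singular_series (pair (fact y * i) (fact y * j)) 2 \<le>
    singular_series (\<lambda>_. fact y * i) 1 * singular_series (\<lambda>_. fact y * j) 1 *
      (1 + divisor_tail y (nat \<bar>int i - int j\<bar>))"
proof -
  define h where "h = nat \<bar>int i - int j\<bar>"
  have h: "h > 0" using ij by (simp add: h_def)
  have "singular_series (pair (fact y * i) (fact y * j)) 2 \<le>
    singular_series (\<lambda>_. fact y * i) 1 * singular_series (\<lambda>_. fact y * j) 1 *
      (\<Prod>p\<in>rough_primes y h. 1 + 1 / (real p - 1))"
  proof (rule singular_series_pair_le)
    fix p assume p: "prime p" "\<not> p dvd fact y * i" "[fact y * i = fact y * j] (mod p)"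
    then have nd: "\<not> p dvd fact y" by (metis dvd_mult2)
    then have "y < p" using p(1) prime_dvd_fact_iff[of p y] by simp
    have "coprime (fact y) p"
      using p(1) nd by (metis coprime_commute prime_imp_coprime)
    then have "[i = j] (mod p)" using p(3) by (simp only: cong_mult_lcancel_nat)
    then have "[int i = int j] (mod int p)" by (simp only: cong_int_iff)
    then have "p dvd h" unfolding h_def dvd_nat_abs_iff by (simp only: cong_iff_dvd_diff)
    with \<open>y < p\<close> show "p \<in> rough_primes y h" using p(1) by (simp add: rough_primes_def)
  qed (use ij h in \<open>auto simp: rough_primes_def intro: finite_rough_primes prime_gt_Suc_0_nat\<close>)
  also have "\<dots> \<le> singular_series (\<lambda>_. fact y * i) 1 * singular_series (\<lambda>_. fact y * j) 1 *
      (1 + divisor_tail y h)"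
  proof (intro mult_left_mono rough_product_le h y mult_nonneg_nonneg)
    show "0 \<le> singular_series (\<lambda>_. fact y * i) 1" "0 \<le> singular_series (\<lambda>_. fact y * j) 1"
      using singular_series_single_ge_1[of "fact y * i"] singular_series_single_ge_1[of "fact y * j"] ij
      by auto
  qed
  finally show ?thesis unfolding h_def .
qed

section \<open>The second moment of the number of admissible multipliers\<close>

definition dyadic_ints :: "real \<Rightarrow> int set" where
  "dyadic_ints x = {q. x \<le> of_int q \<and> of_int q < 2 * x}"

lemma dyadic_ints_eq: "dyadic_ints x = {\<lceil>x\<rceil>..<\<lceil>2 * x\<rceil>}"
  by (auto simp: dyadic_ints_def ceiling_le_iff less_ceiling_iff)

lemma finite_dyadic_ints [simp]: "finite (dyadic_ints x)"
  by (simp add: dyadic_ints_eq)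

lemma card_dyadic_ints_le: "x \<ge> 0 \<Longrightarrow> real (card (dyadic_ints x)) \<le> x + 1"
  unfolding dyadic_ints_eq by simp linarith

definition prime_ind :: "nat \<Rightarrow> int \<Rightarrow> real" where
  "prime_ind k q = of_bool (prime (q * int k + 1))"

lemma sum_prime_ind:
  "(\<Sum>q\<in>dyadic_ints x. prime_ind k q) = real (tuplet_count (\<lambda>_. k) 1 x)"
proof -
  have "{q. x \<le> of_int q \<and> of_int q < 2 * x \<and> (\<forall>j\<in>{1..1::nat}. prime (q * int k + 1))} =
      {q \<in> dyadic_ints x. prime (q * int k + 1)}"
    by (auto simp: dyadic_ints_def)
  then show ?thesis
    by (simp only: tuplet_count_def prime_ind_def) (simp add: sum_of_bool_eq Int_def)
qed

lemma sum_prime_ind_mult: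
  "(\<Sum>q\<in>dyadic_ints x. prime_ind a q * prime_ind b q) = real (tuplet_count (pair a b) 2 x)"
proof -
  have two: "{1..2::nat} = {1, 2}" by auto
  have "{q. x \<le> of_int q \<and> of_int q < 2 * x \<and> (\<forall>j\<in>{1..2}. prime (q * int (pair a b j) + 1))} =
      {q \<in> dyadic_ints x. prime (q * int a + 1) \<and> prime (q * int b + 1)}"
    unfolding two by (auto simp: dyadic_ints_def pair_def)
  then show ?thesis
    by (simp only: tuplet_count_def prime_ind_def of_bool_conj[symmetric]) (simp add: sum_of_bool_eq Int_def)
qed

lemma eventually_single_count:
  assumes "prime_tuplets_conjecture" "b > 0" "\<eta> > 0"
  shows "\<forall>\<^sub>F x in at_top. \<forall>k. 0 < k \<and> real k \<le> b * ln x \<longrightarrow>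
    \<bar>real (tuplet_count (\<lambda>_. k) 1 x) - x / ln x * singular_series (\<lambda>_. k) 1\<bar>
      \<le> \<eta> * (x / ln x * singular_series (\<lambda>_. k) 1)"
proof -
  from assms have "\<forall>\<^sub>F x in at_top. \<forall>r.
          inj_on r {1..1::nat} \<and> (\<forall>j\<in>{1..1}. 0 < r j \<and> real (r j) \<le> b * ln x) \<longrightarrow>
          \<bar>real (tuplet_count r 1 x) - x / ln x ^ 1 * singular_series r 1\<bar>
            \<le> \<eta> * (x / ln x ^ 1 * singular_series r 1)"
    unfolding prime_tuplets_conjecture_def by blast
  then show ?thesis by eventually_elim simp
qed

lemma eventually_pair_count:
  assumes "prime_tuplets_conjecture" "b > 0" "\<eta> > 0"
  shows "\<forall>\<^sub>F x in at_top. \<forall>k k'. 0 < k \<and> 0 < k' \<and> k \<noteq> k' \<and> real k \<le> b * ln x \<and> real k' \<le> b * ln x \<longrightarrow>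
    real (tuplet_count (pair k k') 2 x) \<le> (1 + \<eta>) * (x / ln x ^ 2 * singular_series (pair k k') 2)"
proof -
  have "(1::nat) \<le> 2" by simp
  with assms have "\<forall>\<^sub>F x in at_top. \<forall>r.
          inj_on r {1..2::nat} \<and> (\<forall>j\<in>{1..2}. 0 < r j \<and> real (r j) \<le> b * ln x) \<longrightarrow>
          \<bar>real (tuplet_count r 2 x) - x / ln x ^ 2 * singular_series r 2\<bar>
            \<le> \<eta> * (x / ln x ^ 2 * singular_series r 2)"
    unfolding prime_tuplets_conjecture_def by blast
  then show ?thesis
  proof eventually_elim
    case (elim x)
    show ?case
    proof (intro allI impI)
      fix k k' assume k: "0 < k \<and> 0 < k' \<and> k \<noteq> k' \<and> real k \<le> b * ln x \<and> real k' \<le> b * ln x"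
      then have "inj_on (pair k k') {1..2} \<and> (\<forall>j\<in>{1..2}. 0 < pair k k' j \<and> real (pair k k' j) \<le> b * ln x)"
        by (auto simp: inj_on_def pair_def)
      with elim have "\<bar>real (tuplet_count (pair k k') 2 x) - x / ln x ^ 2 * singular_series (pair k k') 2\<bar>
            \<le> \<eta> * (x / ln x ^ 2 * singular_series (pair k k') 2)" by blast
      then show "real (tuplet_count (pair k k') 2 x) \<le> (1 + \<eta>) * (x / ln x ^ 2 * singular_series (pair k k') 2)"
        by (simp only: abs_le_iff distrib_right) linarith
    qed
  qed
qed

text \<open>
  Chebyshev's inequality, with \<open>m\<close> an approximation to the mean of \<open>f\<close>: every zero of \<open>f\<close>
  contributes \<open>m\<^sup>2\<close> to the sum of \<open>(f q - m)\<^sup>2\<close>.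
\<close>

lemma second_moment_zeros:
  fixes f :: "'a \<Rightarrow> real"
  assumes "finite Q"
  shows "real (card {q \<in> Q. f q = 0}) * m\<^sup>2
    \<le> (\<Sum>q\<in>Q. (f q)\<^sup>2) - 2 * m * (\<Sum>q\<in>Q. f q) + m\<^sup>2 * real (card Q)"
proof -
  have "real (card {q \<in> Q. f q = 0}) * m\<^sup>2 = (\<Sum>q | q \<in> Q \<and> f q = 0. (f q - m)\<^sup>2)"
    by simp
  also have "\<dots> \<le> (\<Sum>q\<in>Q. (f q - m)\<^sup>2)"
    using assms by (intro sum_mono2) auto
  also have "\<dots> = (\<Sum>q\<in>Q. (f q)\<^sup>2) - 2 * m * (\<Sum>q\<in>Q. f q) + m\<^sup>2 * real (card Q)"
  proof -
    have "(f q - m)\<^sup>2 = (f q)\<^sup>2 - 2 * m * f q + m\<^sup>2" for q by (simp add: power2_diff)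
    then show ?thesis by (simp add: sum.distrib sum_subtractf flip: sum_distrib_left)
  qed
  finally show ?thesis .
qed

text \<open>
  The weight \<open>w j\<close> cancels the singular series of the single form, so that each \<open>j\<close> contributes
  about \<open>x / ln x\<close> to the first moment, and each pair \<open>i \<noteq> j\<close> at most about
  \<open>x / (ln x)\<^sup>2 * (1 + divisor_tail y \<bar>i - j\<bar>)\<close> to the second. The diagonal terms contribute
  \<open>x * m\<close>, which is small compared with \<open>x * m\<^sup>2\<close> when \<open>m\<close> is large.
\<close>

lemma weighted_count_moments:
  fixes y n :: nat and x \<eta> \<tau> :: real
  defines "k \<equiv> \<lambda>j. fact y * j :: nat"
  defines "w \<equiv> \<lambda>j. 1 / singular_series (\<lambda>_. k j) 1"
  defines "f \<equiv> \<lambda>q. \<Sum>j\<in>{1..n}. w j * prime_ind (k j) q"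
  defines "m \<equiv> real n / ln x"
  assumes x: "x > 1" and y: "y \<ge> 2" and \<eta>: "0 \<le> \<eta>"
    and tail: "(\<Sum>d\<in>{y<..n}. 1 / (real d * sqrt (real d))) \<le> \<tau>"
    and single: "\<And>j. j \<in> {1..n} \<Longrightarrow>
      \<bar>real (tuplet_count (\<lambda>_. k j) 1 x) - x / ln x * singular_series (\<lambda>_. k j) 1\<bar>
        \<le> \<eta> * (x / ln x * singular_series (\<lambda>_. k j) 1)"
    and two: "\<And>i j. i \<in> {1..n} \<Longrightarrow> j \<in> {1..n} \<Longrightarrow> i \<noteq> j \<Longrightarrow>
      real (tuplet_count (pair (k i) (k j)) 2 x)
        \<le> (1 + \<eta>) * (x / ln x ^ 2 * singular_series (pair (k i) (k j)) 2)"
  shows "(1 - \<eta>) * x * m \<le> (\<Sum>q\<in>dyadic_ints x. f q)"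
    and "(\<Sum>q\<in>dyadic_ints x. (f q)\<^sup>2) \<le> (1 + \<eta>) * x * (m + m\<^sup>2 * (1 + 2 * \<tau>))"
proof -
  have L: "ln x > 0" using x by simp
  define S where "S j = singular_series (\<lambda>_. k j) 1" for j
  have S1: "1 \<le> S j" if "j \<in> {1..n}" for j
    unfolding S_def k_def using that by (intro singular_series_single_ge_1) simp
  have w: "w j = 1 / S j" "0 < w j" "w j \<le> 1" "w j * S j = 1" if "j \<in> {1..n}" for j
    using S1[OF that] by (auto simp: w_def S_def)
  have lower: "(1 - \<eta>) * (x / ln x) \<le> w j * real (tuplet_count (\<lambda>_. k j) 1 x)"
    and upper: "w j * real (tuplet_count (\<lambda>_. k j) 1 x) \<le> (1 + \<eta>) * (x / ln x)"
    if j: "j \<in> {1..n}" for j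
  proof -
    have eq: "c * (x / ln x) = w j * (c * (x / ln x * S j))" for c
      using w(4)[OF j] by (metis mult.assoc mult.commute mult.right_neutral)
    have "(1 - \<eta>) * (x / ln x * S j) \<le> real (tuplet_count (\<lambda>_. k j) 1 x)"
      "real (tuplet_count (\<lambda>_. k j) 1 x) \<le> (1 + \<eta>) * (x / ln x * S j)"
      using single[OF j] unfolding S_def by (simp_all only: abs_le_iff distrib_right left_diff_distrib) linarith+
    then show "(1 - \<eta>) * (x / ln x) \<le> w j * real (tuplet_count (\<lambda>_. k j) 1 x)"
      "w j * real (tuplet_count (\<lambda>_. k j) 1 x) \<le> (1 + \<eta>) * (x / ln x)"
      unfolding eq using w(2)[OF j] by (intro mult_left_mono; simp)+
  qed
  have "(1 - \<eta>) * x * m = (\<Sum>j\<in>{1..n}. (1 - \<eta>) * (x / ln x))"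
    by (simp add: m_def)
  also have "\<dots> \<le> (\<Sum>j\<in>{1..n}. w j * real (tuplet_count (\<lambda>_. k j) 1 x))"
    by (intro sum_mono lower)
  also have "\<dots> = (\<Sum>j\<in>{1..n}. \<Sum>q\<in>dyadic_ints x. w j * prime_ind (k j) q)"
    by (simp only: sum_prime_ind[symmetric] sum_distrib_left)
  also have "\<dots> = (\<Sum>q\<in>dyadic_ints x. f q)"
    unfolding f_def by (rule sum.swap)
  finally show "(1 - \<eta>) * x * m \<le> (\<Sum>q\<in>dyadic_ints x. f q)" .

  define s where "s i j = divisor_tail y (nat \<bar>int i - int j\<bar>)" for i j
  have off: "w i * w j * real (tuplet_count (pair (k i) (k j)) 2 x)
      \<le> (1 + \<eta>) * (x / (ln x)\<^sup>2) * (1 + s i j)"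
    if ij: "i \<in> {1..n}" "j \<in> {1..n}" "i \<noteq> j" for i j
  proof -
    have "real (tuplet_count (pair (k i) (k j)) 2 x)
        \<le> (1 + \<eta>) * (x / ln x ^ 2 * singular_series (pair (k i) (k j)) 2)"
      by (rule two[OF ij])
    also have "\<dots> \<le> (1 + \<eta>) * (x / ln x ^ 2 * (S i * S j * (1 + s i j)))"
      unfolding S_def s_def k_def using \<eta> x ij y
      by (intro mult_left_mono singular_series_multiples_le) auto
    finally have "w i * w j * real (tuplet_count (pair (k i) (k j)) 2 x)
        \<le> w i * w j * ((1 + \<eta>) * (x / ln x ^ 2 * (S i * S j * (1 + s i j))))"
      using w(2)[OF ij(1)] w(2)[OF ij(2)] by (intro mult_left_mono) auto
    also have "\<dots> = (w i * S i) * (w j * S j) * ((1 + \<eta>) * (x / (ln x)\<^sup>2) * (1 + s i j))"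
      by (simp add: mult_ac)
    finally show ?thesis using w(4) ij by simp
  qed
  have diag: "w i * w i * real (tuplet_count (\<lambda>_. k i) 1 x) \<le> (1 + \<eta>) * (x / ln x)"
    if i: "i \<in> {1..n}" for i
  proof -
    have "w i * (w i * real (tuplet_count (\<lambda>_. k i) 1 x)) \<le> 1 * (w i * real (tuplet_count (\<lambda>_. k i) 1 x))"
      using w[OF i] by (intro mult_right_mono) auto
    with upper[OF i] show ?thesis by simp
  qed
  have row: "(\<Sum>j\<in>{1..n}. w i * w j * (\<Sum>q\<in>dyadic_ints x. prime_ind (k i) q * prime_ind (k j) q))
      \<le> (1 + \<eta>) * (x / ln x) + (1 + \<eta>) * (x / (ln x)\<^sup>2) * (real n * (1 + 2 * \<tau>))"
    if i: "i \<in> {1..n}" for i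
  proof -
    have "(\<Sum>j\<in>{1..n} - {i}. 1 + s i j) \<le> real n + 2 * (real n * \<tau>)"
    proof -
      have "(\<Sum>j\<in>{1..n} - {i}. s i j) \<le> 2 * (\<Sum>h\<in>{1..n}. divisor_tail y h)"
        unfolding s_def by (intro sum_off_diagonal_le divisor_tail_nonneg i)
      also have "\<dots> \<le> 2 * (real n * \<tau>)"
        using sum_divisor_tail_le[of y n] mult_left_mono[OF tail, of "real n"] by simp
      finally have "(\<Sum>j\<in>{1..n} - {i}. s i j) \<le> 2 * (real n * \<tau>)" .
      moreover have "card ({1..n} - {i}) \<le> card {1..n}" by (intro card_mono) auto
      ultimately show ?thesis by (simp add: sum.distrib)
    qed
    then have tot: "(\<Sum>j\<in>{1..n} - {i}. 1 + s i j) \<le> real n * (1 + 2 * \<tau>)" by (simp add: algebra_simps)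
    have "(\<Sum>j\<in>{1..n}. w i * w j * (\<Sum>q\<in>dyadic_ints x. prime_ind (k i) q * prime_ind (k j) q)) =
        w i * w i * (\<Sum>q\<in>dyadic_ints x. prime_ind (k i) q * prime_ind (k i) q) +
        (\<Sum>j\<in>{1..n} - {i}. w i * w j * (\<Sum>q\<in>dyadic_ints x. prime_ind (k i) q * prime_ind (k j) q))"
      by (rule sum.remove) (use i in auto)
    also have "(\<Sum>q\<in>dyadic_ints x. prime_ind (k i) q * prime_ind (k i) q) =
        real (tuplet_count (\<lambda>_. k i) 1 x)"
      unfolding sum_prime_ind[symmetric] by (simp add: prime_ind_def)
    also have "w i * w i * real (tuplet_count (\<lambda>_. k i) 1 x) +
        (\<Sum>j\<in>{1..n} - {i}. w i * w j * (\<Sum>q\<in>dyadic_ints x. prime_ind (k i) q * prime_ind (k j) q))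
      \<le> (1 + \<eta>) * (x / ln x) + (\<Sum>j\<in>{1..n} - {i}. (1 + \<eta>) * (x / (ln x)\<^sup>2) * (1 + s i j))"
      unfolding sum_prime_ind_mult using i by (intro add_mono sum_mono diag off) auto
    also have "\<dots> = (1 + \<eta>) * (x / ln x) + (1 + \<eta>) * (x / (ln x)\<^sup>2) * (\<Sum>j\<in>{1..n} - {i}. 1 + s i j)"
      by (simp only: sum_distrib_left)
    also have "\<dots> \<le> (1 + \<eta>) * (x / ln x) + (1 + \<eta>) * (x / (ln x)\<^sup>2) * (real n * (1 + 2 * \<tau>))"
      using \<eta> x tot by (intro add_left_mono mult_left_mono) auto
    finally show ?thesis .
  qed
  have "(\<Sum>q\<in>dyadic_ints x. (f q)\<^sup>2) =
      (\<Sum>q\<in>dyadic_ints x. \<Sum>i\<in>{1..n}. \<Sum>j\<in>{1..n}. w i * w j * (prime_ind (k i) q * prime_ind (k j) q))"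
    unfolding f_def power2_eq_square sum_product by (simp only: mult_ac)
  also have "\<dots> = (\<Sum>i\<in>{1..n}. \<Sum>j\<in>{1..n}. \<Sum>q\<in>dyadic_ints x. w i * w j * (prime_ind (k i) q * prime_ind (k j) q))"
    by (subst sum.swap, rule sum.cong[OF refl], rule sum.swap)
  also have "\<dots> \<le> (\<Sum>i\<in>{1..n}. (1 + \<eta>) * (x / ln x) + (1 + \<eta>) * (x / (ln x)\<^sup>2) * (real n * (1 + 2 * \<tau>)))"
    unfolding sum_distrib_left[symmetric] by (intro sum_mono row)
  also have "\<dots> = (1 + \<eta>) * x * (m + m\<^sup>2 * (1 + 2 * \<tau>))"
    using L by (simp add: m_def field_simps power2_eq_square)
  finally show "(\<Sum>q\<in>dyadic_ints x. (f q)\<^sup>2) \<le> (1 + \<eta>) * x * (m + m\<^sup>2 * (1 + 2 * \<tau>))" .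
qed

text \<open>
  The arithmetic behind the choice of parameters. After division by \<open>m\<^sup>2\<close> the bound for \<open>c\<close> is
  \<open>x\<close> times a sum of four terms: \<open>(1 + \<eta>) / m\<close> from the diagonal, \<open>2 * \<tau> * (1 + \<eta>)\<close> from the
  correlations, \<open>3 * \<eta>\<close> from the error in (C), and \<open>1 / x\<close> from counting the integers in an
  interval. Each is at most \<open>\<epsilon> / 4\<close>.
\<close>

lemma moment_ratio_bound:
  fixes x m c a2 a1 \<eta> \<tau> \<epsilon> card_Q :: real
  assumes "0 < \<epsilon>" "0 \<le> \<eta>" "\<eta> \<le> 1" "\<eta> \<le> \<epsilon> / 12" "\<tau> = \<epsilon> / 16" "m \<ge> 8 / \<epsilon>" "x \<ge> 4 / \<epsilon>"
    and "c * m\<^sup>2 \<le> a2 - 2 * m * a1 + m\<^sup>2 * card_Q"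
    and "a2 \<le> (1 + \<eta>) * x * (m + m\<^sup>2 * (1 + 2 * \<tau>))" "(1 - \<eta>) * x * m \<le> a1" "card_Q \<le> x + 1"
  shows "c \<le> \<epsilon> * x"
proof -
  have m: "m > 0" using assms(1,6) by (smt (verit) divide_pos_pos)
  have x: "x > 0" using assms(1,7) by (smt (verit) divide_pos_pos)
  have me: "8 \<le> \<epsilon> * m" "4 \<le> \<epsilon> * x" using assms(1,6,7) by (simp_all add: field_simps)
  have e1: "(1 + \<eta>) * x * m \<le> \<epsilon> / 4 * x * m\<^sup>2"
  proof -
    have "(1 + \<eta>) * (x * m) \<le> (\<epsilon> / 4 * m) * (x * m)"
      using assms(3) me m x by (intro mult_right_mono) auto
    then show ?thesis by (simp add: power2_eq_square mult_ac)
  qed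
  have e2: "(1 + \<eta>) * (2 * \<tau>) * (x * m\<^sup>2) \<le> \<epsilon> / 4 * (x * m\<^sup>2)"
  proof -
    have "(1 + \<eta>) * (2 * \<tau>) \<le> 2 * (2 * \<tau>)" using assms(1,3,5) by (intro mult_right_mono) auto
    then show ?thesis using x assms(5) by (intro mult_right_mono) auto
  qed
  have e3: "3 * \<eta> * (x * m\<^sup>2) \<le> \<epsilon> / 4 * (x * m\<^sup>2)"
    using assms(4) x by (intro mult_right_mono) auto
  have e4: "m\<^sup>2 \<le> \<epsilon> / 4 * x * m\<^sup>2"
    using mult_right_mono[of 1 "\<epsilon> / 4 * x" "m\<^sup>2"] me by simp
  have "c * m\<^sup>2 \<le> (1 + \<eta>) * x * (m + m\<^sup>2 * (1 + 2 * \<tau>)) - 2 * m * ((1 - \<eta>) * x * m) + m\<^sup>2 * (x + 1)"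
  proof -
    have "2 * m * ((1 - \<eta>) * x * m) \<le> 2 * m * a1" using assms(10) m by (intro mult_left_mono) auto
    moreover have "m\<^sup>2 * card_Q \<le> m\<^sup>2 * (x + 1)" using assms(11) by (intro mult_left_mono) auto
    ultimately show ?thesis using assms(8,9) by linarith
  qed
  also have "\<dots> = (1 + \<eta>) * x * m + (1 + \<eta>) * (2 * \<tau>) * (x * m\<^sup>2) + 3 * \<eta> * (x * m\<^sup>2) + m\<^sup>2"
    by (simp add: power2_eq_square algebra_simps)
  also have "\<dots> \<le> \<epsilon> * x * m\<^sup>2"
  proof -
    have "\<epsilon> * x * m\<^sup>2 = \<epsilon> / 4 * x * m\<^sup>2 + \<epsilon> / 4 * (x * m\<^sup>2) + \<epsilon> / 4 * (x * m\<^sup>2) + \<epsilon> / 4 * x * m\<^sup>2"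
      by simp
    then show ?thesis using add_mono[OF add_mono[OF add_mono[OF e1 e2] e3] e4] by (simp only:)
  qed
  finally show ?thesis using m by simp
qed

lemma few_without_small_multiplier:
  assumes C: "prime_tuplets_conjecture" and \<epsilon>: "\<epsilon> > 0"
  shows "\<exists>b>0. \<forall>\<^sub>F x in at_top.
    real (card {q \<in> dyadic_ints x. \<not> (\<exists>k>0. real k \<le> b * ln x \<and> prime (q * int k + 1))}) \<le> \<epsilon> * x"
proof -
  define \<eta> where "\<eta> = min 1 (\<epsilon> / 12)"
  define \<tau> where "\<tau> = \<epsilon> / 16"
  define M where "M = 8 / \<epsilon> + 1"
  have pos: "\<eta> > 0" "\<tau> > 0" "M > 0" using \<epsilon> by (auto simp: \<eta>_def \<tau>_def M_def add_pos_pos)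
  \<comment> \<open>First make the correlations small by the choice of \<open>y\<close>, then \<open>b\<close> so large that
    \<open>M * ln x\<close> multiples of \<open>fact y\<close> lie below \<open>b * ln x\<close>.\<close>
  obtain y where y: "y \<ge> 2" "\<And>n. (\<Sum>d\<in>{y<..n}. 1 / (real d * sqrt (real d))) \<le> \<tau>"
    using tail_three_halves_small[OF pos(2)] by blast
  define b where "b = fact y * M"
  have b: "b > 0" using pos by (simp add: b_def)
  have "\<forall>\<^sub>F x in at_top.
    real (card {q \<in> dyadic_ints x. \<not> (\<exists>k>0. real k \<le> b * ln x \<and> prime (q * int k + 1))}) \<le> \<epsilon> * x"
    using eventually_single_count[OF C b pos(1)] eventually_pair_count[OF C b pos(1)]
      eventually_ge_at_top[of "4 / \<epsilon>"] eventually_ge_at_top[of "exp 1"]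
  proof eventually_elim
    case (elim x)
    have "exp 1 > (1::real)" by simp
    then have x1: "x > 1" using elim(4) by linarith
    then have L: "ln x \<ge> 1" using elim(4) by (simp add: ln_ge_iff)
    define n where "n = nat \<lfloor>M * ln x\<rfloor>"
    have n: "real n \<le> M * ln x" "M * ln x - 1 \<le> real n"
      using pos L by (auto simp: n_def)
    define k :: "nat \<Rightarrow> nat" where "k j = fact y * j" for j
    have k: "0 < k j" "real (k j) \<le> b * ln x" if "j \<in> {1..n}" for j
    proof -
      show "0 < k j" using that by (simp add: k_def)
      have "real j \<le> M * ln x" using that n(1) by (auto intro: order.trans)
      then show "real (k j) \<le> b * ln x" by (simp add: k_def b_def mult.assoc)
    qed
    define f where "f q = (\<Sum>j\<in>{1..n}. 1 / singular_series (\<lambda>_. k j) 1 * prime_ind (k j) q)" for q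
    define m where "m = real n / ln x"
    \<comment> \<open>Rounding \<open>M * ln x\<close> down to \<open>n\<close> costs at most the \<open>1\<close> in the definition of \<open>M\<close>.\<close>
    have mM: "m \<ge> 8 / \<epsilon>"
    proof -
      have "M * ln x - ln x \<le> real n" using n(2) L by linarith
      then have "8 / \<epsilon> * ln x \<le> real n" by (simp add: M_def algebra_simps)
      then show ?thesis using L by (simp add: m_def pos_le_divide_eq)
    qed
    have "k i \<noteq> k j" if "i \<noteq> j" for i j using that by (simp add: k_def)
    then have moments: "(1 - \<eta>) * x * m \<le> (\<Sum>q\<in>dyadic_ints x. f q)"
      "(\<Sum>q\<in>dyadic_ints x. (f q)\<^sup>2) \<le> (1 + \<eta>) * x * (m + m\<^sup>2 * (1 + 2 * \<tau>))"
      unfolding f_def m_def k_def using x1 y pos(1) elim(1,2) k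
      by (intro weighted_count_moments; auto simp: k_def)+
    have "real (card {q \<in> dyadic_ints x. f q = 0}) \<le> \<epsilon> * x"
      by (rule moment_ratio_bound[OF \<epsilon> _ _ _ \<tau>_def mM elim(3)
            second_moment_zeros[OF finite_dyadic_ints] moments(2,1) card_dyadic_ints_le])
        (use \<epsilon> x1 in \<open>auto simp: \<eta>_def\<close>)
    moreover have "card {q \<in> dyadic_ints x. \<not> (\<exists>k>0. real k \<le> b * ln x \<and> prime (q * int k + 1))}
        \<le> card {q \<in> dyadic_ints x. f q = 0}"
    proof (rule card_mono)
      show "{q \<in> dyadic_ints x. \<not> (\<exists>k>0. real k \<le> b * ln x \<and> prime (q * int k + 1))}
        \<subseteq> {q \<in> dyadic_ints x. f q = 0}"
      proof (intro Collect_mono impI conjI; elim conjE)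
        fix q assume "\<not> (\<exists>k>0. real k \<le> b * ln x \<and> prime (q * int k + 1))"
        then have "prime_ind (k j) q = 0" if "j \<in> {1..n}" for j
          using k[OF that] by (auto simp: prime_ind_def)
        then show "f q = 0" unfolding f_def by simp
      qed
    qed simp
    ultimately show ?case by linarith
  qed
  with b show ?thesis by blast
qed

section \<open>The size of the least multiplier\<close>

lemma prime_int_nat_linear: "prime (int n * int k + 1) \<longleftrightarrow> prime (k * n + 1)"
proof -
  have "int n * int k + 1 = int (k * n + 1)" by (simp add: mult.commute)
  then show ?thesis by (metis prime_nat_int_transfer)
qed

lemma card_nat_le_card_dyadic_ints:
  "card {n::nat. x \<le> real n \<and> real n < 2 * x \<and> P (int n)} \<le> card {q \<in> dyadic_ints x. P q}"
proof (rule card_inj_on_le[of int])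
  have "{q \<in> dyadic_ints x. P q} \<subseteq> dyadic_ints x" by blast
  then show "finite {q \<in> dyadic_ints x. P q}" by (rule finite_subset) simp
qed (auto simp: inj_on_def dyadic_ints_def)

lemma almost_all_multiplier_le:
  assumes C: "prime_tuplets_conjecture"
  shows "for_almost_all_odd (\<lambda>n. \<exists>k>0. real k \<le> (ln (real n))\<^sup>2 \<and> prime (k * n + 1))"
proof (rule for_almost_all_odd_dyadic)
  fix \<epsilon> :: real assume "\<epsilon> > 0"
  from few_without_small_multiplier[OF C this] obtain b where b: "b > 0"
    "\<forall>\<^sub>F x in at_top. real (card {q \<in> dyadic_ints x.
      \<not> (\<exists>k>0. real k \<le> b * ln x \<and> prime (q * int k + 1))}) \<le> \<epsilon> * x" by blast
  have "\<forall>\<^sub>F x in at_top. b * ln x \<le> (ln x)\<^sup>2" by real_asymp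
  with b(2) eventually_ge_at_top[of 1]
  show "\<forall>\<^sub>F x in at_top. real (card {n. x \<le> real n \<and> real n < 2 * x \<and>
      \<not> (\<exists>k>0. real k \<le> (ln (real n))\<^sup>2 \<and> prime (k * n + 1))}) \<le> \<epsilon> * x"
  proof eventually_elim
    case (elim x)
    have "{n. x \<le> real n \<and> real n < 2 * x \<and> \<not> (\<exists>k>0. real k \<le> (ln (real n))\<^sup>2 \<and> prime (k * n + 1))}
      \<subseteq> {n. x \<le> real n \<and> real n < 2 * x \<and> \<not> (\<exists>k>0. real k \<le> b * ln x \<and> prime (int n * int k + 1))}"
    proof (intro Collect_mono impI conjI notI; elim conjE exE)
      fix n k assume *: "x \<le> real n" "\<not> (\<exists>k>0. real k \<le> (ln (real n))\<^sup>2 \<and> prime (k * n + 1))"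
        "0 < k" "real k \<le> b * ln x" "prime (int n * int k + 1)"
      have "(ln x)\<^sup>2 \<le> (ln (real n))\<^sup>2" using elim(2) *(1) by (intro power_mono) auto
      with elim(3) *(4) have "real k \<le> (ln (real n))\<^sup>2" by linarith
      with * show False unfolding prime_int_nat_linear by blast
    qed
    then have "card {n. x \<le> real n \<and> real n < 2 * x \<and> \<not> (\<exists>k>0. real k \<le> (ln (real n))\<^sup>2 \<and> prime (k * n + 1))}
      \<le> card {n. x \<le> real n \<and> real n < 2 * x \<and> \<not> (\<exists>k>0. real k \<le> b * ln x \<and> prime (int n * int k + 1))}"
      by (rule card_mono[rotated])
        (rule finite_subset[OF _ finite_nat_real_le[of "2 * x" "\<lambda>_. True"]], auto)
    also have "\<dots> \<le> card {q \<in> dyadic_ints x. \<not> (\<exists>k>0. real k \<le> b * ln x \<and> prime (q * int k + 1))}"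
      by (rule card_nat_le_card_dyadic_ints)
    finally show ?case using elim(1) by linarith
  qed
qed

text \<open>
  The union bound over all \<open>k \<le> t\<close> with \<open>t = (ln (2 * x)) powr (1 / 3)\<close>: by (C) for one form and
  the trivial bound \<open>k\<close> for the singular series, at most \<open>2 * t * x / ln x\<close> integers are excluded
  for each \<open>k\<close>, hence at most \<open>2 * t\<^sup>2 * x / ln x\<close> in total. Any exponent below \<open>1 / 2\<close> would do.
\<close>

lemma almost_all_multiplier_ge:
  assumes C: "prime_tuplets_conjecture"
  shows "for_almost_all_odd (\<lambda>n. \<forall>k>0. prime (k * n + 1) \<longrightarrow> ln (real n) powr (1 / 3) < real k)"
proof (rule for_almost_all_odd_dyadic)
  fix \<epsilon> :: real assume \<epsilon>: "\<epsilon> > 0"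
  have 1: "\<forall>\<^sub>F x in at_top. ln (2 * x) powr (1 / 3) \<le> ln (x::real)"
    and 2: "\<forall>\<^sub>F x in at_top. (ln (2 * x) powr (1 / 3))\<^sup>2 * 2 / ln x \<le> \<epsilon>"
    using \<epsilon> by real_asymp+
  from eventually_single_count[OF C zero_less_one zero_less_one] 1 2 eventually_gt_at_top[of 1]
  show "\<forall>\<^sub>F x in at_top. real (card {n. x \<le> real n \<and> real n < 2 * x \<and>
      \<not> (\<forall>k>0. prime (k * n + 1) \<longrightarrow> ln (real n) powr (1 / 3) < real k)}) \<le> \<epsilon> * x"
  proof eventually_elim
    case (elim x)
    have double: "u \<le> 2 * v" if "\<bar>u - v\<bar> \<le> 1 * v" for u v :: real
      using that by linarith
    define t where "t = ln (2 * x) powr (1 / 3)"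
    define ks where "ks = {1..nat \<lfloor>t\<rfloor>}"
    have ks: "real k \<le> t" if "k \<in> ks" for k
    proof -
      have "0 \<le> t" by (simp add: t_def)
      moreover have "real k \<le> real (nat \<lfloor>t\<rfloor>)" using that by (simp add: ks_def)
      ultimately show ?thesis using of_nat_floor[of t] by linarith
    qed
    have card_ks: "real (card ks) \<le> t" by (simp add: ks_def t_def)
    have "{n. x \<le> real n \<and> real n < 2 * x \<and>
        \<not> (\<forall>k>0. prime (k * n + 1) \<longrightarrow> ln (real n) powr (1 / 3) < real k)}
      \<subseteq> (\<Union>k\<in>ks. {n. x \<le> real n \<and> real n < 2 * x \<and> prime (int n * int k + 1)})"
    proof
      fix n assume "n \<in> {n. x \<le> real n \<and> real n < 2 * x \<and>
        \<not> (\<forall>k>0. prime (k * n + 1) \<longrightarrow> ln (real n) powr (1 / 3) < real k)}"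
      then obtain k where k: "x \<le> real n" "real n < 2 * x" "0 < k" "prime (k * n + 1)"
        "real k \<le> ln (real n) powr (1 / 3)" by (auto simp: not_less)
      have "ln (real n) powr (1 / 3) \<le> t"
        unfolding t_def using k(1,2) elim(4) by (intro powr_mono2) auto
      with k(5) have "k \<le> nat \<lfloor>t\<rfloor>" by (intro le_nat_floor) linarith
      with k(3) have "k \<in> ks" by (simp add: ks_def)
      with k(1,2,4) show "n \<in> (\<Union>k\<in>ks. {n. x \<le> real n \<and> real n < 2 * x \<and> prime (int n * int k + 1)})"
        unfolding prime_int_nat_linear by blast
    qed
    moreover have "finite {n. x \<le> real n \<and> real n < 2 * x \<and> prime (int n * int k + 1)}" for k
      by (rule finite_subset[OF _ finite_nat_real_le[of "2 * x" "\<lambda>_. True"]]) auto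
    then have "finite (\<Union>k\<in>ks. {n. x \<le> real n \<and> real n < 2 * x \<and> prime (int n * int k + 1)})"
      by (intro finite_UN_I) (simp_all add: ks_def)
    ultimately have "card {n. x \<le> real n \<and> real n < 2 * x \<and>
        \<not> (\<forall>k>0. prime (k * n + 1) \<longrightarrow> ln (real n) powr (1 / 3) < real k)}
      \<le> card (\<Union>k\<in>ks. {n. x \<le> real n \<and> real n < 2 * x \<and> prime (int n * int k + 1)})"
      by (rule card_mono[rotated])
    also have "\<dots> \<le> (\<Sum>k\<in>ks. card {n. x \<le> real n \<and> real n < 2 * x \<and> prime (int n * int k + 1)})"
      by (rule card_UN_le) (simp add: ks_def)
    also have "\<dots> \<le> (\<Sum>k\<in>ks. tuplet_count (\<lambda>_. k) 1 x)"
    proof (rule sum_mono)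
      fix k
      have "card {n. x \<le> real n \<and> real n < 2 * x \<and> prime (int n * int k + 1)}
          \<le> card {q \<in> dyadic_ints x. prime (q * int k + 1)}"
        by (rule card_nat_le_card_dyadic_ints)
      also have "\<dots> = tuplet_count (\<lambda>_. k) 1 x"
        unfolding tuplet_count_def dyadic_ints_def by (rule arg_cong[of _ _ card]) auto
      finally show "card {n. x \<le> real n \<and> real n < 2 * x \<and> prime (int n * int k + 1)}
          \<le> tuplet_count (\<lambda>_. k) 1 x" .
    qed
    finally have "real (card {n. x \<le> real n \<and> real n < 2 * x \<and>
        \<not> (\<forall>k>0. prime (k * n + 1) \<longrightarrow> ln (real n) powr (1 / 3) < real k)})
      \<le> (\<Sum>k\<in>ks. real (tuplet_count (\<lambda>_. k) 1 x))"
      unfolding of_nat_sum[symmetric] of_nat_le_iff .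
    also have "\<dots> \<le> (\<Sum>k\<in>ks. 2 * (x / ln x) * t)"
    proof (rule sum_mono)
      fix k assume k: "k \<in> ks"
      then have k0: "0 < k" by (simp add: ks_def)
      have "real k \<le> 1 * ln x" using ks[OF k] elim(2) by (simp add: t_def)
      with elim(1) k0 have
        "\<bar>real (tuplet_count (\<lambda>_. k) 1 x) - x / ln x * singular_series (\<lambda>_. k) 1\<bar>
          \<le> 1 * (x / ln x * singular_series (\<lambda>_. k) 1)" by blast
      then have "real (tuplet_count (\<lambda>_. k) 1 x) \<le> 2 * (x / ln x * singular_series (\<lambda>_. k) 1)"
        by (rule double)
      also have "\<dots> \<le> 2 * (x / ln x * t)"
        using singular_series_single_le[OF k0] ks[OF k] elim(4)
        by (intro mult_left_mono) auto
      finally show "real (tuplet_count (\<lambda>_. k) 1 x) \<le> 2 * (x / ln x) * t" by (simp add: mult_ac)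
    qed
    also have "\<dots> \<le> t * (2 * (x / ln x) * t)"
      unfolding sum_constant using card_ks elim(4) by (intro mult_right_mono) (auto simp: t_def)
    also have "\<dots> = (t\<^sup>2 * 2 / ln x) * x" by (simp add: power2_eq_square)
    also have "\<dots> \<le> \<epsilon> * x" using elim(3,4) by (intro mult_right_mono) (auto simp: t_def)
    finally show ?case .
  qed
qed

text \<open>
  The existence of some admissible \<open>k\<close>, which is what makes \<open>\<kappa> n\<close> meaningful, is part of the upper
  bound.
\<close>

lemma almost_all_kappa_bounds:
  assumes "prime_tuplets_conjecture"
  shows "for_almost_all_odd (\<lambda>n. ln (real n) powr (1 / 3) < real (\<kappa> n) \<and> real (\<kappa> n) \<le> (ln (real n))\<^sup>2)"
proof (rule for_almost_all_odd_mono[OF for_almost_all_odd_conj[OF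
      almost_all_multiplier_ge[OF assms] almost_all_multiplier_le[OF assms]]])
  fix n
  assume *: "(\<forall>k>0. prime (k * n + 1) \<longrightarrow> ln (real n) powr (1 / 3) < real k) \<and>
    (\<exists>k>0. real k \<le> (ln (real n))\<^sup>2 \<and> prime (k * n + 1))"
  then obtain k where k: "0 < k \<and> prime (k * n + 1)" "real k \<le> (ln (real n))\<^sup>2" by blast
  from k(1) have "0 < \<kappa> n \<and> prime (\<kappa> n * n + 1)" unfolding \<kappa>_def by (rule LeastI)
  moreover from k(1) have "\<kappa> n \<le> k" unfolding \<kappa>_def by (rule Least_le)
  then have "real (\<kappa> n) \<le> real k" by simp
  ultimately show "ln (real n) powr (1 / 3) < real (\<kappa> n) \<and> real (\<kappa> n) \<le> (ln (real n))\<^sup>2"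
    using * k(2) by auto
qed

theorem proposition9p2p4:
  assumes A: "\<exists>c>0. for_almost_all_odd (\<lambda>n. log_mahler_C (\<kappa> n) \<ge> c * ln (real (\<kappa> n)))"
    and B: "\<exists>c1>0. \<exists>c2>0. for_almost_all_odd (\<lambda>n.
              c1 * log_mahler_C (\<kappa> n) \<le> log_mahler (gaussian_period n) / real n \<and>
              log_mahler (gaussian_period n) / real n \<le> c2 * log_mahler_C (\<kappa> n))"
    and C: "prime_tuplets_conjecture"
  shows "\<exists>c3>0. \<exists>c4>0. for_almost_all_odd (\<lambda>n.
           c3 * real n * ln (ln (real n)) \<le> log_mahler (gaussian_period n) \<and>
           log_mahler (gaussian_period n) \<le> c4 * real n * ln (ln (real n)))"
proof -
  obtain c where c: "c > 0" "for_almost_all_odd (\<lambda>n. log_mahler_C (\<kappa> n) \<ge> c * ln (real (\<kappa> n)))"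
    using A by blast
  obtain c1 c2 where c12: "c1 > 0" "c2 > 0" "for_almost_all_odd (\<lambda>n.
              c1 * log_mahler_C (\<kappa> n) \<le> log_mahler (gaussian_period n) / real n \<and>
              log_mahler (gaussian_period n) / real n \<le> c2 * log_mahler_C (\<kappa> n))"
    using B by blast
  have large: "for_almost_all_odd (\<lambda>n. ln (real n) \<ge> 2)"
  proof (rule for_almost_all_odd_eventually)
    show "\<forall>\<^sub>F x in at_top. \<forall>n. x \<le> real n \<longrightarrow> 2 \<le> ln (real n)"
      using eventually_ge_at_top[of "exp 2"]
    proof eventually_elim
      case (elim x)
      show ?case
      proof (intro allI impI)
        fix n assume "x \<le> real n"
        with elim have "exp 2 \<le> real n" by linarith
        moreover from this have "0 < real n" by (rule less_le_trans[OF exp_gt_zero])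
        ultimately show "2 \<le> ln (real n)" by (simp only: ln_ge_iff)
      qed
    qed
  qed
  have "for_almost_all_odd (\<lambda>n.
      c1 * c / 3 * real n * ln (ln (real n)) \<le> log_mahler (gaussian_period n) \<and>
      log_mahler (gaussian_period n) \<le> 3 * c2 * real n * ln (ln (real n)))"
  proof (rule for_almost_all_odd_mono[OF for_almost_all_odd_conj[OF
        for_almost_all_odd_conj[OF c(2) c12(3)]
        for_almost_all_odd_conj[OF almost_all_kappa_bounds[OF C] large]]], elim conjE)
    fix n
    define L where "L = ln (real n)"
    define C where "C = log_mahler_C (\<kappa> n)"
    assume "c * ln (real (\<kappa> n)) \<le> log_mahler_C (\<kappa> n)"
      and "c1 * log_mahler_C (\<kappa> n) \<le> log_mahler (gaussian_period n) / real n"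
      and "log_mahler (gaussian_period n) / real n \<le> c2 * log_mahler_C (\<kappa> n)"
      and "ln (real n) powr (1 / 3) < real (\<kappa> n)" "real (\<kappa> n) \<le> (ln (real n))\<^sup>2" "2 \<le> ln (real n)"
    then have *: "c * ln (real (\<kappa> n)) \<le> C" "c1 * C \<le> log_mahler (gaussian_period n) / real n"
      "log_mahler (gaussian_period n) / real n \<le> c2 * C"
      "L powr (1 / 3) < real (\<kappa> n)" "real (\<kappa> n) \<le> L\<^sup>2" "2 \<le> L"
      by (simp_all add: L_def C_def)
    have n: "real n > 0" using *(6) by (cases "n = 0") (auto simp: L_def)
    have k: "\<kappa> n > 0" using *(4) powr_ge_zero[of L "1 / 3"] by (cases "\<kappa> n = 0") auto
    have "1 / 3 * ln L = ln (L powr (1 / 3))" using *(6) by (simp add: ln_powr)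
    also have "\<dots> \<le> ln (real (\<kappa> n))" using *(4,6) by (intro ln_mono) auto
    finally have "c * (1 / 3 * ln L) \<le> c * ln (real (\<kappa> n))" using c(1) by (intro mult_left_mono) auto
    with *(1) have "c * (1 / 3 * ln L) \<le> C" by linarith
    then have "c1 * (c * (1 / 3 * ln L)) \<le> c1 * C" using c12(1) by (intro mult_left_mono) auto
    with *(2) have "c1 * (c * (1 / 3 * ln L)) \<le> log_mahler (gaussian_period n) / real n" by linarith
    then have low: "c1 * c / 3 * real n * ln L \<le> log_mahler (gaussian_period n)"
      using n by (simp add: field_simps)
    \<comment> \<open>As \<open>L \<ge> 2\<close>, passing from \<open>\<kappa> n\<close> to \<open>\<kappa> n + 1\<close> raises the bound \<open>L\<^sup>2\<close> to at most \<open>L ^ 3\<close>.\<close>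
    have "1 \<le> L\<^sup>2" using *(6) by (intro one_le_power) simp
    moreover have "2 * L\<^sup>2 \<le> L * L\<^sup>2" using *(6) by (intro mult_right_mono) auto
    ultimately have "real (\<kappa> n) + 1 \<le> L ^ 3" using *(5) by (simp add: power3_eq_cube power2_eq_square)
    then have "ln (real (\<kappa> n) + 1) \<le> ln (L ^ 3)" using *(6) by (intro ln_mono) auto
    also have "\<dots> = 3 * ln L" using *(6) by (simp add: ln_realpow)
    finally have "C \<le> 3 * ln L" using log_mahler_C_le[OF k] by (simp add: C_def)
    then have "c2 * C \<le> c2 * (3 * ln L)" using c12(2) by (intro mult_left_mono) auto
    with *(3) have "log_mahler (gaussian_period n) / real n \<le> c2 * (3 * ln L)" by linarith
    then have "log_mahler (gaussian_period n) \<le> 3 * c2 * real n * ln L"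
      using n by (simp add: field_simps)
    with low show "c1 * c / 3 * real n * ln (ln (real n)) \<le> log_mahler (gaussian_period n) \<and>
      log_mahler (gaussian_period n) \<le> 3 * c2 * real n * ln (ln (real n))"
      by (simp add: L_def)
  qed
  moreover have "c1 * c / 3 > 0" "3 * c2 > 0" using c(1) c12(1,2) by simp_all
  ultimately show ?thesis by blast
qed

end
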